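(* Let $n\ge 1$, let $A=A_1\times\cdots\times A_n$ and $B=B_1\times\cdots\times B_n$ be products of finite sets, and let $\alpha_0,\alpha_1\in\mathrm{Prob}^A$, $\beta_0,\beta_1\in\mathrm{Prob}^B$. Consider the bit-commitment based coin-flipping protocol with parameters $(\alpha_0,\alpha_1,\beta_0,\beta_1)$. For each $c\in\{0,1\}$, the maximum probability $P_{\mathrm{A},c}^*$ with which cheating Alice can force honest Bob to accept outcome $c$ is given by the optimal objective function value of the following convex optimization problem: $$P_{\mathrm{A},c}^* = \max\left\{ \frac12 \sum_{a\in\{0,1\}}\sum_{y\in B} \beta_{a\oplus c,y}\ \mathrm{F}\left(s^{(a,y)},\alpha_a\right) : (s_1,\ldots,s_n,s)\in\mathcal{P}_{\mathrm A}\right\},$$ where $s^{(a,y)}\in\mathbb{R}_+^A$ is the restriction of $s$ with the indices $(a,y)$ fixed, i.e., $[s^{(a,y)}]_x=s_{a,x,y}$.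
   Context: Notation. For a finite set $S$: $\mathbb{R}_+^S$ is the set of nonnegative real vectors indexed by $S$; $\mathrm{Prob}^S$ is the set of probability vectors indexed by $S$; $e_x$ ($x\in S$) are the standard basis vectors; $e_S$ is the all-ones vector. $\oplus$ is XOR of bits. For $p,q\in\mathbb{R}_+^S$ the fidelity is $\mathrm{F}(p,q)=\left(\sum_{x\in S}\sqrt{p_x}\sqrt{q_x}\right)^2$. For a vector $v\in\mathbb{R}^{S\times T}$, the partial trace over $S$ is $\mathrm{Tr}_S(v)\in\mathbb{R}^T$, $[\mathrm{Tr}_S(v)]_t=\sum_{s\in S}v_{s,t}$ (and $\mathrm{Tr}_S(v)=\sum_{s\in S} v_s$ for $v\in\mathbb{R}^S$). Equalities between vectors indexed by products of sets are understood by matching coordinates by label. Alice's cheating polytope $\mathcal{P}_{\mathrm A}$ is the set of all $(s_1,\ldots,s_n,s)$ with $s_1\in\mathbb{R}_+^{A_1}$, $s_j\in\mathbb{R}_+^{A_1\times B_1\times\cdots\times B_{j-1}\times A_j}$ for $j=2,\ldots,n$, $s\in\mathbb{R}_+^{A_0'\times A\times B}$ (where $A_0'=\{0,1\}$), satisfying $\mathrm{Tr}_{A_1}(s_1)=1$, $\mathrm{Tr}_{A_j}(s_j)=s_{j-1}\otimes e_{B_{j-1}}$ for $j=2,\ldots,n$, and $\mathrm{Tr}_{A_0'}(s)=s_n\otimes e_{B_n}$. Protocol. Let $A'=A$ and $B'=B$ be copies, and $A_0=A_0'=B_0=B_0'=\{0,1\}$; a set is used as a label for the quantum register with state space $\mathbb{C}^{\text{set}}$.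 Put $\psi_a=\sum_{x\in A}\sqrt{\alpha_{a,x}}\,e_x\otimes e_x\in\mathbb{C}^A\otimes\mathbb{C}^{A'}$, $\psi=\sum_{a\in\{0,1\}}\frac{1}{\sqrt2}e_a\otimes e_a\otimes\psi_a\in\mathbb{C}^{A_0}\otimes\mathbb{C}^{A_0'}\otimes\mathbb{C}^A\otimes\mathbb{C}^{A'}$, $\phi_b=\sum_{y\in B}\sqrt{\beta_{b,y}}\,e_y\otimes e_y\in\mathbb{C}^B\otimes\mathbb{C}^{B'}$, $\phi=\sum_{b\in\{0,1\}}\frac{1}{\sqrt2}e_b\otimes e_b\otimes\phi_b\in\mathbb{C}^{B_0}\otimes\mathbb{C}^{B_0'}\otimes\mathbb{C}^B\otimes\mathbb{C}^{B'}$. Alice prepares $\psi$ and Bob prepares $\phi$. For $i=1,\ldots,n$: Alice sends $\mathbb{C}^{A_i}$ to Bob, who replies with $\mathbb{C}^{B_i}$. Then Alice sends $\mathbb{C}^{A_0'}$ and $\mathbb{C}^{A'}$ to Bob, and then Bob sends $\mathbb{C}^{B_0'}$ and $\mathbb{C}^{B'}$ to Alice. Finally Alice measures registers $A_0,B_0',B,B'$ with the POVM $(\Pi_{\mathrm A,0},\Pi_{\mathrm A,1},\Pi_{\mathrm A,\mathrm{abort}})$, where $\Pi_{\mathrm A,c}=\sum_{b\in\{0,1\}}e_{b\oplus c}e_{b\oplus c}^*\otimes e_be_b^*\otimes\phi_b\phi_b^*$ and $\Pi_{\mathrm A,\mathrm{abort}}=\mathrm I-\Pi_{\mathrm A,0}-\Pi_{\mathrm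 A,1}$; Bob measures registers $B_0,A_0',A,A'$ with $(\Pi_{\mathrm B,0},\Pi_{\mathrm B,1},\Pi_{\mathrm B,\mathrm{abort}})$, where $\Pi_{\mathrm B,c}=\sum_{a\in\{0,1\}}e_{a\oplus c}e_{a\oplus c}^*\otimes e_ae_a^*\otimes\psi_a\psi_a^*$ and $\Pi_{\mathrm B,\mathrm{abort}}=\mathrm I-\Pi_{\mathrm B,0}-\Pi_{\mathrm B,1}$. The measurement outcome is the party's output. Cheating. A cheating party may use a private workspace of arbitrary finite dimension, an arbitrary initial state (unentangled with the honest party), arbitrary quantum operations on the qubits in its possession between messages, and an arbitrary final measurement; the only restriction is that its messages have the dimensions prescribed by the protocol. The other party follows the protocol. $P_{\mathrm A,c}^*$ is the supremum, over all cheating strategies of Alice, of the probability that honest Bob outputs $c$. *)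

theory Defs
  imports "HOL-Analysis.Analysis"
begin

text \<open>
  Bits are booleans, with \<open>False\<close> for 0 and \<open>True\<close> for 1; the XOR of two bits is \<open>a \<noteq> c\<close>.

  The protocol has parameters \<open>n\<close>, finite sets \<open>A i\<close> and \<open>B i\<close> for \<open>i\<close> in \<open>{1..n}\<close>, and vectors
  \<open>\<alpha> b\<close> and \<open>\<beta> b\<close> for a bit \<open>b\<close>. The product of the sets with labels in \<open>L\<close> is \<open>PiE L A\<close>, so that
  coordinates are matched by label; in particular \<open>PiE {} A\<close> has the single element
  \<open>\<lambda>_. undefined\<close>, and \<open>x(i := undefined)\<close> removes the coordinate \<open>i\<close>.
\<close>


section \<open>Real vectors\<close>

text \<open>A real vector indexed by \<open>S\<close> is a function of which only the values on \<open>S\<close> are relevant.\<close>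

definition prob_vector :: "'i set \<Rightarrow> ('i \<Rightarrow> real) \<Rightarrow> bool" where
  "prob_vector S p \<longleftrightarrow> (\<forall>x\<in>S. 0 \<le> p x) \<and> (\<Sum>x\<in>S. p x) = 1"

definition fidelity :: "'i set \<Rightarrow> ('i \<Rightarrow> real) \<Rightarrow> ('i \<Rightarrow> real) \<Rightarrow> real" where
  "fidelity S p q = (\<Sum>x\<in>S. sqrt (p x) * sqrt (q x))\<^sup>2"

definition basis_vec :: "'i \<Rightarrow> 'i \<Rightarrow> complex" where
  "basis_vec x = (\<lambda>z. of_bool (z = x))"


section \<open>Operators on labelled finite-dimensional registers\<close>

text \<open>
  A matrix with rows and columns indexed by \<open>I\<close> is a function vanishing outside \<open>I \<times> I\<close>.
\<close>

type_synonym 'i op = "'i \<Rightarrow> 'i \<Rightarrow> complex"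

definition operators :: "'i set \<Rightarrow> 'i op set" where
  "operators I = {X. \<forall>i j. i \<notin> I \<or> j \<notin> I \<longrightarrow> X i j = 0}"

definition op_trace :: "'i set \<Rightarrow> 'i op \<Rightarrow> complex" where
  "op_trace I X = (\<Sum>i\<in>I. X i i)"

definition op_mult :: "'i set \<Rightarrow> 'i op \<Rightarrow> 'i op \<Rightarrow> 'i op" where
  "op_mult I X Y = (\<lambda>i j. \<Sum>k\<in>I. X i k * Y k j)"

definition op_tensor :: "'i op \<Rightarrow> 'k op \<Rightarrow> ('i \<times> 'k) op" where
  "op_tensor X Y = (\<lambda>(i, k) (j, l). X i j * Y k l)"

definition rank_one :: "('i \<Rightarrow> complex) \<Rightarrow> 'i op" where
  "rank_one v = (\<lambda>i j. v i * cnj (v j))"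

definition psd :: "'i set \<Rightarrow> 'i op \<Rightarrow> bool" where
  "psd I X \<longleftrightarrow> X \<in> operators I \<and>
     (\<forall>v. (\<Sum>i\<in>I. \<Sum>j\<in>I. cnj (v i) * X i j * v j) \<in> \<real>\<^sub>\<ge>\<^sub>0)"

definition density_op :: "'i set \<Rightarrow> 'i op \<Rightarrow> bool" where
  "density_op I \<rho> \<longleftrightarrow> psd I \<rho> \<and> op_trace I \<rho> = 1"

definition linear_super :: "'i set \<Rightarrow> 'j set \<Rightarrow> ('i op \<Rightarrow> 'j op) \<Rightarrow> bool" where
  "linear_super I J \<Phi> \<longleftrightarrow>
     (\<forall>X\<in>operators I. \<Phi> X \<in> operators J) \<and>
     (\<forall>X\<in>operators I. \<forall>Y\<in>operators I.
        \<Phi> (\<lambda>i j. X i j + Y i j) = (\<lambda>i j. \<Phi> X i j + \<Phi> Y i j)) \<and>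
     (\<forall>c. \<forall>X\<in>operators I. \<Phi> (\<lambda>i j. c * X i j) = (\<lambda>i j. c * \<Phi> X i j))"

text \<open>
  The superoperator \<open>\<Phi> \<otimes> id\<close>, applied blockwise: the block of a matrix \<open>X\<close> belonging to the basis
  elements \<open>k\<close>, \<open>l\<close> of the second factor is a matrix on the first factor.
\<close>

definition super_tensor_id :: "('i op \<Rightarrow> 'j op) \<Rightarrow> ('i \<times> 'k) op \<Rightarrow> ('j \<times> 'k) op" where
  "super_tensor_id \<Phi> X = (\<lambda>(i, k) (j, l). \<Phi> (\<lambda>i' j'. X (i', k) (j', l)) i j)"

text \<open>Complete positivity is positivity of \<open>\<Phi> \<otimes> id\<close> for every finite-dimensional ancilla.\<close>

definition quantum_channel :: "'i set \<Rightarrow> 'j set \<Rightarrow> ('i op \<Rightarrow> 'j op) \<Rightarrow> bool" where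
  "quantum_channel I J \<Phi> \<longleftrightarrow>
     linear_super I J \<Phi> \<and>
     (\<forall>X\<in>operators I. op_trace J (\<Phi> X) = op_trace I X) \<and>
     (\<forall>m::nat. \<forall>X. psd (I \<times> {..<m}) X \<longrightarrow> psd (J \<times> {..<m}) (super_tensor_id \<Phi> X))"

definition povm :: "'i set \<Rightarrow> nat \<Rightarrow> (nat \<Rightarrow> 'i op) \<Rightarrow> bool" where
  "povm I m M \<longleftrightarrow> (\<forall>k<m. psd I (M k)) \<and>
     (\<forall>i\<in>I. \<forall>j\<in>I. (\<Sum>k<m. M k i j) = of_bool (i = j))"

text \<open>
  A regrouping of tensor factors: \<open>g\<close> maps the basis \<open>J\<close> of the new grouping bijectively onto the
  basis of the old one.
\<close>

definition regroup :: "'j set \<Rightarrow> ('j \<Rightarrow> 'i) \<Rightarrow> 'i op \<Rightarrow> 'j op" where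
  "regroup J g X = (\<lambda>u v. if u \<in> J \<and> v \<in> J then X (g u) (g v) else 0)"


section \<open>Honest Bob\<close>

definition psi_vec ::
  "nat \<Rightarrow> (nat \<Rightarrow> 'a set) \<Rightarrow> (bool \<Rightarrow> (nat \<Rightarrow> 'a) \<Rightarrow> real) \<Rightarrow> bool \<Rightarrow> (nat \<Rightarrow> 'a) \<times> (nat \<Rightarrow> 'a) \<Rightarrow> complex"
where
  "psi_vec n A \<alpha> a = (\<lambda>(x, x'). \<Sum>z\<in>PiE {1..n} A.
     complex_of_real (sqrt (\<alpha> a z)) * basis_vec z x * basis_vec z x')"

definition phi_vec ::
  "nat \<Rightarrow> (nat \<Rightarrow> 'b set) \<Rightarrow> (bool \<Rightarrow> (nat \<Rightarrow> 'b) \<Rightarrow> real) \<Rightarrow> bool \<Rightarrow> (nat \<Rightarrow> 'b) \<times> (nat \<Rightarrow> 'b) \<Rightarrow> complex"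
where
  "phi_vec n B \<beta> b = (\<lambda>(y, y'). \<Sum>z\<in>PiE {1..n} B.
     complex_of_real (sqrt (\<beta> b z)) * basis_vec z y * basis_vec z y')"

text \<open>Bob's initial state, on the registers \<open>B\<^sub>0, B\<^sub>0', B, B'\<close>.\<close>

definition phi_state ::
  "nat \<Rightarrow> (nat \<Rightarrow> 'b set) \<Rightarrow> (bool \<Rightarrow> (nat \<Rightarrow> 'b) \<Rightarrow> real) \<Rightarrow>
   bool \<times> bool \<times> (nat \<Rightarrow> 'b) \<times> (nat \<Rightarrow> 'b) \<Rightarrow> complex"
where
  "phi_state n B \<beta> = (\<lambda>(b0, b0', y, y'). \<Sum>b\<in>UNIV.
     complex_of_real (1 / sqrt 2) * basis_vec b b0 * basis_vec b b0' * phi_vec n B \<beta> b (y, y'))"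

text \<open>Bob's measurement operator for the outcome \<open>c\<close>, on the registers \<open>B\<^sub>0, A\<^sub>0', A, A'\<close>.\<close>

definition bob_accept ::
  "nat \<Rightarrow> (nat \<Rightarrow> 'a set) \<Rightarrow> (bool \<Rightarrow> (nat \<Rightarrow> 'a) \<Rightarrow> real) \<Rightarrow> bool \<Rightarrow>
   (bool \<times> bool \<times> (nat \<Rightarrow> 'a) \<times> (nat \<Rightarrow> 'a)) op"
where
  "bob_accept n A \<alpha> c = (\<lambda>p q. \<Sum>a\<in>UNIV.
     op_tensor (rank_one (basis_vec (a \<noteq> c)))
       (op_tensor (rank_one (basis_vec a)) (rank_one (psi_vec n A \<alpha> a))) p q)"


section \<open>Cheating Alice\<close>

text \<open>
  A strategy consists of

  \<^item> the dimension \<open>ws_dim i\<close> of the private workspace left after sending the \<open>i\<close>-th message, where the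
    transmission of \<open>A\<^sub>0', A'\<close> is message \<open>n + 1\<close>;
  \<^item> an initial state of the first message and the workspace;
  \<^item> for \<open>1 \<le> i < n\<close>, an operation taking workspace and Bob's message \<open>B\<^sub>i\<close> to the next message
    \<open>A\<^bsub>i+1\<^esub>\<close> and the new workspace (which may store \<open>B\<^sub>i\<close>);
  \<^item> an operation taking workspace and \<open>B\<^sub>n\<close> to \<open>A\<^sub>0', A'\<close> and the new workspace;
  \<^item> a measurement with \<open>n_out\<close> outcomes of the workspace and Bob's last message \<open>B\<^sub>0', B'\<close>.
\<close>

record ('a, 'b) alice_strategy =
  ws_dim :: "nat \<Rightarrow> nat"
  init_state :: "('a \<times> nat) op"
  round_op :: "nat \<Rightarrow> (nat \<times> 'b) op \<Rightarrow> ('a \<times> nat) op"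
  reveal_op :: "(nat \<times> 'b) op \<Rightarrow> ((bool \<times> (nat \<Rightarrow> 'a)) \<times> nat) op"
  n_out :: nat
  final_meas :: "nat \<Rightarrow> (nat \<times> bool \<times> (nat \<Rightarrow> 'b)) op"

definition alice_final_basis ::
  "nat \<Rightarrow> (nat \<Rightarrow> 'b set) \<Rightarrow> ('a, 'b) alice_strategy \<Rightarrow> (nat \<times> bool \<times> (nat \<Rightarrow> 'b)) set"
where
  "alice_final_basis n B S = {..<ws_dim S (Suc n)} \<times> UNIV \<times> PiE {1..n} B"

definition valid_strategy ::
  "nat \<Rightarrow> (nat \<Rightarrow> 'a set) \<Rightarrow> (nat \<Rightarrow> 'b set) \<Rightarrow> ('a, 'b) alice_strategy \<Rightarrow> bool"
where
  "valid_strategy n A B S \<longleftrightarrow>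
     density_op (A 1 \<times> {..<ws_dim S 1}) (init_state S) \<and>
     (\<forall>i\<in>{1..<n}. quantum_channel ({..<ws_dim S i} \<times> B i) (A (Suc i) \<times> {..<ws_dim S (Suc i)})
        (round_op S i)) \<and>
     quantum_channel ({..<ws_dim S n} \<times> B n) ((UNIV \<times> PiE {1..n} A) \<times> {..<ws_dim S (Suc n)})
        (reveal_op S) \<and>
     povm (alice_final_basis n B S) (n_out S) (final_meas S)"


section \<open>Interaction with honest Bob\<close>

text \<open>
  A joint state is an operator on a product whose first factor belongs to Alice. After \<open>i\<close> rounds Bob
  holds \<open>A\<^sub>1, \<dots>, A\<^sub>i\<close>, \<open>B\<^sub>0\<close>, \<open>B\<^sub>0'\<close>, \<open>B\<^bsub>i+1\<^esub>, \<dots>, B\<^sub>n\<close> and \<open>B'\<close>, in this order.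
\<close>

type_synonym ('a, 'b) bob_regs = "(nat \<Rightarrow> 'a) \<times> bool \<times> bool \<times> (nat \<Rightarrow> 'b) \<times> (nat \<Rightarrow> 'b)"

definition bob_basis ::
  "nat \<Rightarrow> (nat \<Rightarrow> 'a set) \<Rightarrow> (nat \<Rightarrow> 'b set) \<Rightarrow> nat \<Rightarrow> ('a, 'b) bob_regs set"
where
  "bob_basis n A B i = PiE {1..i} A \<times> UNIV \<times> UNIV \<times> PiE {i<..n} B \<times> PiE {1..n} B"

definition bob_final_basis ::
  "nat \<Rightarrow> (nat \<Rightarrow> 'a set) \<Rightarrow> (bool \<times> bool \<times> (nat \<Rightarrow> 'a) \<times> (nat \<Rightarrow> 'a)) set"
where
  "bob_final_basis n A = UNIV \<times> UNIV \<times> PiE {1..n} A \<times> PiE {1..n} A"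

definition initial_joint ::
  "nat \<Rightarrow> (nat \<Rightarrow> 'b set) \<Rightarrow> (bool \<Rightarrow> (nat \<Rightarrow> 'b) \<Rightarrow> real) \<Rightarrow> ('a, 'b) alice_strategy \<Rightarrow>
   (('a \<times> nat) \<times> ('a, 'b) bob_regs) op"
where
  "initial_joint n B \<beta> S = op_tensor (init_state S)
     (op_tensor (rank_one (basis_vec (\<lambda>_. undefined))) (rank_one (phi_state n B \<beta>)))"

text \<open>Round \<open>i\<close>: Alice hands over \<open>A\<^sub>i\<close> (basis element \<open>x i\<close>) and Bob replies with \<open>B\<^sub>i\<close> (basis element \<open>v\<close>).\<close>

definition exchange ::
  "nat \<Rightarrow> (nat \<Rightarrow> 'a set) \<Rightarrow> (nat \<Rightarrow> 'b set) \<Rightarrow> ('a, 'b) alice_strategy \<Rightarrow> nat \<Rightarrow>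
   (('a \<times> nat) \<times> ('a, 'b) bob_regs) op \<Rightarrow> ((nat \<times> 'b) \<times> ('a, 'b) bob_regs) op"
where
  "exchange n A B S i = regroup (({..<ws_dim S i} \<times> B i) \<times> bob_basis n A B i)
     (\<lambda>((w, v), (x, b0, b0', y, y')).
        ((x i, w), (x(i := undefined), b0, b0', y(i := v), y')))"

text \<open>The joint state after \<open>k\<close> rounds, when Alice has prepared her message \<open>k + 1 \<le> n\<close>.\<close>

primrec joint_state ::
  "nat \<Rightarrow> (nat \<Rightarrow> 'a set) \<Rightarrow> (nat \<Rightarrow> 'b set) \<Rightarrow> (bool \<Rightarrow> (nat \<Rightarrow> 'b) \<Rightarrow> real) \<Rightarrow>
   ('a, 'b) alice_strategy \<Rightarrow> nat \<Rightarrow> (('a \<times> nat) \<times> ('a, 'b) bob_regs) op"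
where
  "joint_state n A B \<beta> S 0 = initial_joint n B \<beta> S"
| "joint_state n A B \<beta> S (Suc k) =
     super_tensor_id (round_op S (Suc k)) (exchange n A B S (Suc k) (joint_state n A B \<beta> S k))"

text \<open>
  The joint state at the end: \<open>A\<^sub>0', A'\<close> have gone to Bob, \<open>B\<^sub>0', B'\<close> to Alice; Bob's registers are listed
  as \<open>B\<^sub>0, A\<^sub>0', A, A'\<close>.
\<close>

definition final_joint ::
  "nat \<Rightarrow> (nat \<Rightarrow> 'a set) \<Rightarrow> (nat \<Rightarrow> 'b set) \<Rightarrow> (bool \<Rightarrow> (nat \<Rightarrow> 'b) \<Rightarrow> real) \<Rightarrow>
   ('a, 'b) alice_strategy \<Rightarrow>
   ((nat \<times> bool \<times> (nat \<Rightarrow> 'b)) \<times> (bool \<times> bool \<times> (nat \<Rightarrow> 'a) \<times> (nat \<Rightarrow> 'a))) op"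
where
  "final_joint n A B \<beta> S = regroup (alice_final_basis n B S \<times> bob_final_basis n A)
     (\<lambda>((w, b0', y'), (b0, a0', x, x')). (((a0', x'), w), (x, b0, b0', (\<lambda>_. undefined), y')))
     (super_tensor_id (reveal_op S) (exchange n A B S n (joint_state n A B \<beta> S (n - 1))))"

text \<open>The probability that Bob outputs \<open>c\<close>, summed over the outcomes of Alice's measurement.\<close>

definition bob_output_prob ::
  "nat \<Rightarrow> (nat \<Rightarrow> 'a set) \<Rightarrow> (nat \<Rightarrow> 'b set) \<Rightarrow> (bool \<Rightarrow> (nat \<Rightarrow> 'a) \<Rightarrow> real) \<Rightarrow>
   (bool \<Rightarrow> (nat \<Rightarrow> 'b) \<Rightarrow> real) \<Rightarrow> ('a, 'b) alice_strategy \<Rightarrow> bool \<Rightarrow> real"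
where
  "bob_output_prob n A B \<alpha> \<beta> S c =
     (let J = alice_final_basis n B S \<times> bob_final_basis n A in
      \<Sum>k<n_out S. Re (op_trace J
        (op_mult J (op_tensor (final_meas S k) (bob_accept n A \<alpha> c)) (final_joint n A B \<beta> S))))"

definition P_A_star ::
  "nat \<Rightarrow> (nat \<Rightarrow> 'a set) \<Rightarrow> (nat \<Rightarrow> 'b set) \<Rightarrow> (bool \<Rightarrow> (nat \<Rightarrow> 'a) \<Rightarrow> real) \<Rightarrow>
   (bool \<Rightarrow> (nat \<Rightarrow> 'b) \<Rightarrow> real) \<Rightarrow> bool \<Rightarrow> real"
where
  "P_A_star n A B \<alpha> \<beta> c =
     Sup {bob_output_prob n A B \<alpha> \<beta> S c | S. valid_strategy n A B S}"


section \<open>The optimization problem\<close>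

text \<open>
  A point \<open>(s\<^sub>1, \<dots>, s\<^sub>n, s)\<close> is a pair \<open>(\<sigma>, s)\<close> with \<open>\<sigma> j = s\<^sub>j\<close> for \<open>j\<close> in \<open>{1..n}\<close>; the index of \<open>s\<^sub>j\<close> is
  an element of \<open>A\<^sub>1 \<times> \<dots> \<times> A\<^sub>j\<close> paired with one of \<open>B\<^sub>1 \<times> \<dots> \<times> B\<^bsub>j-1\<^esub>\<close>.
\<close>

type_synonym ('a, 'b) point =
  "(nat \<Rightarrow> (nat \<Rightarrow> 'a) \<times> (nat \<Rightarrow> 'b) \<Rightarrow> real) \<times> (bool \<times> (nat \<Rightarrow> 'a) \<times> (nat \<Rightarrow> 'b) \<Rightarrow> real)"

definition alice_polytope ::
  "nat \<Rightarrow> (nat \<Rightarrow> 'a set) \<Rightarrow> (nat \<Rightarrow> 'b set) \<Rightarrow> ('a, 'b) point set"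
where
  "alice_polytope n A B = {(\<sigma>, s).
     (\<forall>j\<in>{1..n}. \<forall>p \<in> PiE {1..j} A \<times> PiE {1..<j} B. 0 \<le> \<sigma> j p) \<and>
     (\<forall>p \<in> UNIV \<times> PiE {1..n} A \<times> PiE {1..n} B. 0 \<le> s p) \<and>
     (\<Sum>p \<in> PiE {1..1} A \<times> PiE {1..<1} B. \<sigma> 1 p) = 1 \<and>
     (\<forall>j\<in>{2..n}. \<forall>x \<in> PiE {1..<j} A. \<forall>y \<in> PiE {1..<j} B.
        (\<Sum>a\<in>A j. \<sigma> j (x(j := a), y)) = \<sigma> (j - 1) (x, y(j - 1 := undefined))) \<and>
     (\<forall>x \<in> PiE {1..n} A. \<forall>y \<in> PiE {1..n} B.
        (\<Sum>a\<in>UNIV. s (a, x, y)) = \<sigma> n (x, y(n := undefined)))}"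

definition alice_objective ::
  "nat \<Rightarrow> (nat \<Rightarrow> 'a set) \<Rightarrow> (nat \<Rightarrow> 'b set) \<Rightarrow> (bool \<Rightarrow> (nat \<Rightarrow> 'a) \<Rightarrow> real) \<Rightarrow>
   (bool \<Rightarrow> (nat \<Rightarrow> 'b) \<Rightarrow> real) \<Rightarrow> bool \<Rightarrow> ('a, 'b) point \<Rightarrow> real"
where
  "alice_objective n A B \<alpha> \<beta> c = (\<lambda>(\<sigma>, s).
     1 / 2 * (\<Sum>a\<in>UNIV. \<Sum>y \<in> PiE {1..n} B.
       \<beta> (a \<noteq> c) y * fidelity (PiE {1..n} A) (\<lambda>x. s (a, x, y)) (\<alpha> a)))"

definition mix_points :: "real \<Rightarrow> ('a, 'b) point \<Rightarrow> ('a, 'b) point \<Rightarrow> ('a, 'b) point" where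
  "mix_points t = (\<lambda>(\<sigma>, s) (\<sigma>', s').
     (\<lambda>j p. (1 - t) * \<sigma> j p + t * \<sigma>' j p, \<lambda>p. (1 - t) * s p + t * s' p))"

text \<open>Maximizing \<open>f\<close> over \<open>K\<close> is a convex problem: \<open>K\<close> is convex and \<open>f\<close> is concave on it.\<close>

definition convex_maximization_problem ::
  "('a, 'b) point set \<Rightarrow> (('a, 'b) point \<Rightarrow> real) \<Rightarrow> bool"
where
  "convex_maximization_problem K f \<longleftrightarrow>
     (\<forall>p\<in>K. \<forall>q\<in>K. \<forall>t\<in>{0..1}.
        mix_points t p q \<in> K \<and> (1 - t) * f p + t * f q \<le> f (mix_points t p q))"

end

theory Submission
  imports Defs
begin

text \<open>
  The registers \<open>B\<^sub>0\<close>, \<open>B\<^sub>0'\<close>, \<open>B'\<close> of honest Bob hold standard-basis copies of his bit \<open>b\<close> and of his string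
  \<open>y\<close>. His test is diagonal in \<open>B\<^sub>0\<close>, and \<open>B\<^sub>0'\<close>, \<open>B'\<close> end up with Alice, whose final measurement has effects
  that sum to the identity. Hence only the blocks of the joint state that are diagonal in these three
  registers enter the probability of an outcome. In the block of \<open>(b, y)\<close> everything factors: the weight is
  \<open>\<beta> b y / 2\<close>, and what remains is an interaction in which Alice receives the classical letters
  \<open>y 1, \<dots>, y n\<close> (\<open>branch_state\<close>, lemma \<open>joint_state_branch\<close>). Bob accepts \<open>c\<close> with committed bit \<open>a\<close> only for
  \<open>b = (a \<noteq> c)\<close>, and then he projects onto \<open>\<psi>\<^sub>a\<close>; this gives the formula \<open>bob_output_prob_eq\<close>, from which both
  inequalities follow.

  Upper bound. In the branch of \<open>y\<close>, let \<open>\<sigma> j\<close> be the distribution of Bob's record \<open>A\<^sub>1, \<dots>, A\<^sub>j\<close> in the standard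
  basis, and let \<open>s\<close> be that of \<open>A\<^sub>0', A\<close> at the end. Channels preserve the trace, so summing out the last letter
  gives the preceding distribution; and what Alice has sent by round \<open>j\<close> depends on \<open>y\<close> only through
  \<open>y 1, \<dots>, y (j - 1)\<close>. These are exactly the constraints of the polytope (\<open>branch_point_in_polytope\<close>). The
  projection onto \<open>\<psi>\<^sub>a\<close> evaluates a positive semidefinite matrix, whose diagonal is bounded by \<open>s\<close>, at the
  vector of the \<open>sqrt (\<alpha> a x)\<close>. The 2x2 minors bound its off-diagonal entries by geometric means of diagonal
  entries, and the sum of these bounds is the fidelity (\<open>psd_fidelity_bound\<close>).

  Lower bound. A point of the polytope is a causal family of conditional distributions. Alice samples from
  it coherently: she applies isometries with amplitudes \<open>sqrt (\<sigma> (j + 1) / \<sigma> j)\<close>, keeps a copy of the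
  transcript, and sends the copy of \<open>x\<close> as \<open>A'\<close>. The square roots telescope, so each branch ends in a pure state
  with amplitudes \<open>sqrt (s (a, x, y))\<close>, for which all the estimates above are equalities
  (\<open>point_strategy_output_prob\<close>).

  Finally, the objective is concave by the triangle inequality in the plane (\<open>fidelity_concave\<close>), and it
  attains a maximum because the relevant coordinates of the polytope form a compact set
  (\<open>alice_objective_attains_max\<close>). A maximal point yields a strategy that is optimal among all strategies, so
  the supremum over strategies is this maximum.
\<close>

section \<open>Concavity of the objective\<close>

text \<open>
  The mixture of the two fidelities is the squared length of the sum over \<open>x\<close> of the plane vectors with
  coordinates \<open>sqrt ((1 - t) * p x * q x)\<close> and \<open>sqrt (t * p' x * q x)\<close>, while the fidelity of the mixture is the
  square of the sum of their lengths. Complex numbers serve as the plane.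
\<close>
lemma fidelity_concave:
  fixes p p' q :: "'i \<Rightarrow> real"
  assumes p: "\<And>x. x \<in> S \<Longrightarrow> 0 \<le> p x" and p': "\<And>x. x \<in> S \<Longrightarrow> 0 \<le> p' x"
    and q: "\<And>x. x \<in> S \<Longrightarrow> 0 \<le> q x" and t: "0 \<le> t" "t \<le> 1"
  shows "(1 - t) * fidelity S p q + t * fidelity S p' q \<le> fidelity S (\<lambda>x. (1 - t) * p x + t * p' x) q"
proof -
  define f where "f x = Complex (sqrt (1 - t) * (sqrt (p x) * sqrt (q x))) (sqrt t * (sqrt (p' x) * sqrt (q x)))" for x
  have nf: "cmod (f x) = sqrt ((1 - t) * p x + t * p' x) * sqrt (q x)" if "x \<in> S" for x
  proof -
    have "(1 - t) * (p x * q x) + t * (p' x * q x) = ((1 - t) * p x + t * p' x) * q x"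
      by (simp add: algebra_simps)
    then show ?thesis
      using p[OF that] p'[OF that] q[OF that] t
      by (simp add: f_def cmod_def power_mult_distrib flip: real_sqrt_mult)
  qed
  have "(1 - t) * fidelity S p q + t * fidelity S p' q = (cmod (sum f S))\<^sup>2"
    using t by (simp add: cmod_power2 f_def fidelity_def power_mult_distrib flip: sum_distrib_left)
  also have "\<dots> \<le> (\<Sum>x\<in>S. cmod (f x))\<^sup>2"
    by (intro power_mono norm_sum) auto
  also have "\<dots> = fidelity S (\<lambda>x. (1 - t) * p x + t * p' x) q"
    by (simp add: fidelity_def nf cong: sum.cong)
  finally show ?thesis .
qed

lemma alice_polytope_memI:
  assumes "\<And>j x y. j \<in> {1..n} \<Longrightarrow> x \<in> PiE {1..j} A \<Longrightarrow> y \<in> PiE {1..<j} B \<Longrightarrow> 0 \<le> \<sigma> j (x, y)"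
    and "\<And>a x y. x \<in> PiE {1..n} A \<Longrightarrow> y \<in> PiE {1..n} B \<Longrightarrow> 0 \<le> s (a, x, y)"
    and "(\<Sum>p \<in> PiE {1..1} A \<times> PiE {1..<1} B. \<sigma> 1 p) = 1"
    and "\<And>j x y. j \<in> {2..n} \<Longrightarrow> x \<in> PiE {1..<j} A \<Longrightarrow> y \<in> PiE {1..<j} B \<Longrightarrow>
        (\<Sum>a\<in>A j. \<sigma> j (x(j := a), y)) = \<sigma> (j - 1) (x, y(j - 1 := undefined))"
    and "\<And>x y. x \<in> PiE {1..n} A \<Longrightarrow> y \<in> PiE {1..n} B \<Longrightarrow>
        (\<Sum>a\<in>UNIV. s (a, x, y)) = \<sigma> n (x, y(n := undefined))"
  shows "(\<sigma>, s) \<in> alice_polytope n A B"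
  using assms unfolding alice_polytope_def by auto

lemma alice_polytope_memD:
  assumes "(\<sigma>, s) \<in> alice_polytope n A B"
  shows "\<And>j x y. j \<in> {1..n} \<Longrightarrow> x \<in> PiE {1..j} A \<Longrightarrow> y \<in> PiE {1..<j} B \<Longrightarrow> 0 \<le> \<sigma> j (x, y)"
    and "\<And>a x y. x \<in> PiE {1..n} A \<Longrightarrow> y \<in> PiE {1..n} B \<Longrightarrow> 0 \<le> s (a, x, y)"
    and "(\<Sum>p \<in> PiE {1..1} A \<times> PiE {1..<1} B. \<sigma> 1 p) = 1"
    and "\<And>j x y. j \<in> {2..n} \<Longrightarrow> x \<in> PiE {1..<j} A \<Longrightarrow> y \<in> PiE {1..<j} B \<Longrightarrow>
        (\<Sum>a\<in>A j. \<sigma> j (x(j := a), y)) = \<sigma> (j - 1) (x, y(j - 1 := undefined))"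
    and "\<And>x y. x \<in> PiE {1..n} A \<Longrightarrow> y \<in> PiE {1..n} B \<Longrightarrow>
        (\<Sum>a\<in>UNIV. s (a, x, y)) = \<sigma> n (x, y(n := undefined))"
  using assms unfolding alice_polytope_def by auto

lemma alice_polytope_convex:
  assumes "p \<in> alice_polytope n A B" "q \<in> alice_polytope n A B" "0 \<le> t" "t \<le> 1"
  shows "mix_points t p q \<in> alice_polytope n A B"
proof -
  obtain \<sigma> s \<sigma>' s' where pq: "p = (\<sigma>, s)" "q = (\<sigma>', s')"
    by (cases p, cases q)
  note P = alice_polytope_memD[OF assms(1)[unfolded pq]]
  note Q = alice_polytope_memD[OF assms(2)[unfolded pq]]
  show ?thesis
    unfolding pq mix_points_def prod.case
  proof (rule alice_polytope_memI)
    show "(\<Sum>p\<in>PiE {1..1} A \<times> PiE {1..<1} B. (1 - t) * \<sigma> 1 p + t * \<sigma>' 1 p) = 1"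
      using P(3) Q(3) by (simp add: sum.distrib flip: sum_distrib_left)
  next
    fix j x y assume "j \<in> {2..n}" "x \<in> PiE {1..<j} A" "y \<in> PiE {1..<j} B"
    from P(4)[OF this] Q(4)[OF this]
    show "(\<Sum>a\<in>A j. (1 - t) * \<sigma> j (x(j := a), y) + t * \<sigma>' j (x(j := a), y)) =
        (1 - t) * \<sigma> (j - 1) (x, y(j - 1 := undefined)) + t * \<sigma>' (j - 1) (x, y(j - 1 := undefined))"
      by (simp add: sum.distrib flip: sum_distrib_left)
  next
    fix x y assume "x \<in> PiE {1..n} A" "y \<in> PiE {1..n} B"
    from P(5)[OF this] Q(5)[OF this]
    show "(\<Sum>a\<in>UNIV. (1 - t) * s (a, x, y) + t * s' (a, x, y)) =
        (1 - t) * \<sigma> n (x, y(n := undefined)) + t * \<sigma>' n (x, y(n := undefined))"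
      by (simp only: sum.distrib flip: sum_distrib_left)
  qed (use P(1,2) Q(1,2) assms(3,4) in auto)
qed

lemma alice_objective_concave:
  assumes "p \<in> alice_polytope n A B" "q \<in> alice_polytope n A B" "0 \<le> t" "t \<le> 1"
    and \<alpha>: "\<And>a x. x \<in> PiE {1..n} A \<Longrightarrow> 0 \<le> \<alpha> a x"
    and \<beta>: "\<And>b y. y \<in> PiE {1..n} B \<Longrightarrow> 0 \<le> \<beta> b y"
  shows "(1 - t) * alice_objective n A B \<alpha> \<beta> c p + t * alice_objective n A B \<alpha> \<beta> c q
    \<le> alice_objective n A B \<alpha> \<beta> c (mix_points t p q)"
proof -
  obtain \<sigma> s \<sigma>' s' where pq: "p = (\<sigma>, s)" "q = (\<sigma>', s')"
    by (cases p, cases q)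
  note P = alice_polytope_memD[OF assms(1)[unfolded pq]]
  note Q = alice_polytope_memD[OF assms(2)[unfolded pq]]
  let ?F = "\<lambda>s a y. \<beta> (a \<noteq> c) y * fidelity (PiE {1..n} A) (\<lambda>x. s (a, x, y)) (\<alpha> a)"
  have term_le: "(1 - t) * ?F s a y + t * ?F s' a y \<le> ?F (\<lambda>p. (1 - t) * s p + t * s' p) a y"
    if y: "y \<in> PiE {1..n} B" for a y
  proof -
    have "(1 - t) * fidelity (PiE {1..n} A) (\<lambda>x. s (a, x, y)) (\<alpha> a)
        + t * fidelity (PiE {1..n} A) (\<lambda>x. s' (a, x, y)) (\<alpha> a)
      \<le> fidelity (PiE {1..n} A) (\<lambda>x. (1 - t) * s (a, x, y) + t * s' (a, x, y)) (\<alpha> a)"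
      by (rule fidelity_concave) (use P(2) Q(2) \<alpha> y assms in auto)
    from mult_left_mono[OF this \<beta>[OF y]] show ?thesis by (simp add: algebra_simps)
  qed
  have sum_eq: "(\<Sum>a\<in>UNIV. \<Sum>y\<in>PiE {1..n} B. (1 - t) * ?F s a y + t * ?F s' a y) =
      (1 - t) * (\<Sum>a\<in>UNIV. \<Sum>y\<in>PiE {1..n} B. ?F s a y) +
      t * (\<Sum>a\<in>UNIV. \<Sum>y\<in>PiE {1..n} B. ?F s' a y)"
    by (simp only: sum.distrib sum_distrib_left)
  have "(1 - t) * alice_objective n A B \<alpha> \<beta> c p + t * alice_objective n A B \<alpha> \<beta> c q
    = 1 / 2 * (\<Sum>a\<in>UNIV. \<Sum>y\<in>PiE {1..n} B. (1 - t) * ?F s a y + t * ?F s' a y)"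
    unfolding sum_eq by (simp add: alice_objective_def pq field_simps)
  also have "\<dots> \<le> 1 / 2 * (\<Sum>a\<in>UNIV. \<Sum>y\<in>PiE {1..n} B. ?F (\<lambda>p. (1 - t) * s p + t * s' p) a y)"
    by (intro mult_left_mono sum_mono term_le) auto
  finally show ?thesis
    by (simp add: alice_objective_def pq mix_points_def)
qed

section \<open>Strings indexed by initial intervals\<close>

lemma PiE_remove_last: "(y :: nat \<Rightarrow> _) \<in> PiE {1..k} B \<Longrightarrow> y(k := undefined) \<in> PiE {1..<k} B"
  by (auto simp: PiE_def Pi_def extensional_def)

lemma PiE_remove_last_pred: "1 \<le> k \<Longrightarrow> (y :: nat \<Rightarrow> _) \<in> PiE {1..<k} B \<Longrightarrow> y(k - 1 := undefined) \<in> PiE {1..<k - 1} B"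
  by (auto simp: PiE_def Pi_def extensional_def)

lemma PiE_add_last: "1 \<le> k \<Longrightarrow> (x :: nat \<Rightarrow> _) \<in> PiE {1..<k} A \<Longrightarrow> a \<in> A k \<Longrightarrow> x(k := a) \<in> PiE {1..k} A"
  by (auto simp: PiE_def Pi_def extensional_def)

lemma PiE_remove_add: "1 \<le> k \<Longrightarrow> (x :: nat \<Rightarrow> _) \<in> PiE {1..k} A \<Longrightarrow>
   \<exists>x' a. x = x'(k := a) \<and> x' \<in> PiE {1..<k} A \<and> a \<in> A k"
  by (rule exI[of _ "x(k := undefined)"], rule exI[of _ "x k"]) (auto simp: PiE_remove_last simp del: One_nat_def)

lemma PiE_upd_eq_iff:
  fixes x x' :: "nat \<Rightarrow> 'a"
  assumes "x \<in> PiE {1..<i} A" "x' \<in> PiE {1..<i} A"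
  shows "x(i := a) = x'(i := a') \<longleftrightarrow> x = x' \<and> a = a'"
proof
  assume h: "x(i := a) = x'(i := a')"
  have "x j = x' j" for j
  proof (cases "j = i")
    case True then show ?thesis using assms by (auto simp: PiE_def extensional_def)
  next
    case False then show ?thesis using fun_cong[OF h, of j] by simp
  qed
  then have "x = x'" by (rule ext)
  moreover have "a = a'" using fun_cong[OF h, of i] by simp
  ultimately show "x = x' \<and> a = a'" by simp
qed simp

lemma PiE_upd_undefined: "(x :: nat \<Rightarrow> 'a) \<in> PiE {1..<i} A \<Longrightarrow> (x(i := a))(i := undefined) = x"
  by (auto simp: PiE_def extensional_def)

lemma PiE_upd_mem:
  fixes x :: "nat \<Rightarrow> 'a"
  assumes "1 \<le> i" "x \<in> PiE {1..<i} A" "a \<in> A i"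
  shows "x(i := a) \<in> PiE {1..<Suc i} A"
  using PiE_add_last[OF assms] by (simp add: atLeastLessThanSuc_atLeastAtMost)

lemma restrict_extend:
  fixes y :: "nat \<Rightarrow> 'b"
  shows "1 \<le> i \<Longrightarrow> (restrict y {1..<i})(i := y i) = restrict y {1..<Suc i}"
  by (rule ext) (simp add: restrict_def)

section \<open>Attainment of the maximum\<close>

text \<open>
  Every entry is one of the nonnegative summands whose total is an entry of the preceding level, and the
  entries of the first level add up to 1.
\<close>
lemma alice_polytope_le_1:
  assumes n: "n \<ge> 1" and fin: "\<And>i. i \<in> {1..n} \<Longrightarrow> finite (A i)"
    and mem: "(\<sigma>, s) \<in> alice_polytope n A B"
  shows "j \<in> {1..n} \<Longrightarrow> x \<in> PiE {1..j} A \<Longrightarrow> y \<in> PiE {1..<j} B \<Longrightarrow> \<sigma> j (x, y) \<le> 1"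
    and "x \<in> PiE {1..n} A \<Longrightarrow> y \<in> PiE {1..n} B \<Longrightarrow> s (a, x, y) \<le> 1"
proof -
  note P = alice_polytope_memD[OF mem]
  have le: "\<sigma> j (x, y) \<le> 1" if "j \<in> {1..n}" "x \<in> PiE {1..j} A" "y \<in> PiE {1..<j} B" for j x y
    using that
  proof (induction j arbitrary: x y)
    case (Suc j)
    show ?case
    proof (cases "j = 0")
      case True
      have "\<sigma> 1 (x, y) \<le> (\<Sum>p \<in> PiE {1..1} A \<times> PiE {1..<1} B. \<sigma> 1 p)"
        by (rule member_le_sum) (use Suc.prems True n fin P(1)[of 1] in \<open>auto intro!: finite_PiE\<close>)
      with P(3) True show ?thesis by simp
    next
      case False
      obtain x' a where x': "x = x'(Suc j := a)" "x' \<in> PiE {1..<Suc j} A" "a \<in> A (Suc j)"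
        using PiE_remove_add[OF _ Suc.prems(2)] by auto
      have "\<sigma> (Suc j) (x'(Suc j := a), y) \<le> (\<Sum>a\<in>A (Suc j). \<sigma> (Suc j) (x'(Suc j := a), y))"
        by (rule member_le_sum) (use Suc.prems x' fin P(1) PiE_add_last[OF _ x'(2)] in auto)
      also have "\<dots> = \<sigma> j (x', y(j := undefined))"
        using P(4)[of "Suc j" x' y] False x' Suc.prems by auto
      also have "\<dots> \<le> 1"
        by (rule Suc.IH) (use False x'(2) Suc.prems PiE_remove_last_pred[of "Suc j" y B] in
            \<open>auto simp: atLeastLessThanSuc_atLeastAtMost simp del: fun_upd_apply\<close>)
      finally show ?thesis unfolding x'(1) .
    qed
  qed simp
  show "j \<in> {1..n} \<Longrightarrow> x \<in> PiE {1..j} A \<Longrightarrow> y \<in> PiE {1..<j} B \<Longrightarrow> \<sigma> j (x, y) \<le> 1"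
    by (rule le)
  show "s (a, x, y) \<le> 1" if "x \<in> PiE {1..n} A" "y \<in> PiE {1..n} B"
  proof -
    have "s (a, x, y) \<le> (\<Sum>a\<in>UNIV. s (a, x, y))"
      by (rule member_le_sum) (use P(2) that in auto)
    also have "\<dots> \<le> 1"
      using le[of n x "y(n := undefined)"] n that P(5)[OF that] PiE_remove_last[of y n B] by auto
    finally show ?thesis .
  qed
qed

text \<open>
  The constraints leave the values at irrelevant indices free, so the polytope itself is not compact.
  Clipping all values to \<open>{0..1}\<close> moves a point of it into a compact cube and changes no relevant value.
\<close>
definition clip_point :: "('a, 'b) point \<Rightarrow> ('a, 'b) point" where
  "clip_point = (\<lambda>(\<sigma>, s). (\<lambda>j q. max 0 (min 1 (\<sigma> j q)), \<lambda>q. max 0 (min 1 (s q))))"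

definition unit_cube :: "('a, 'b) point set" where
  "unit_cube = PiE UNIV (\<lambda>_. PiE UNIV (\<lambda>_. {0..1})) \<times> PiE UNIV (\<lambda>_. {0..1})"

lemma clip_point_unit_cube: "clip_point p \<in> unit_cube"
  by (cases p) (auto simp: clip_point_def unit_cube_def)

lemma compact_PiE_UNIV:
  fixes S :: "'i \<Rightarrow> 'x::topological_space set"
  assumes "\<And>i. compact (S i)"
  shows "compact (PiE UNIV S)"
  using assms compactin_PiE[of "\<lambda>_. euclidean" UNIV S] by (auto simp: euclidean_product_topology)

lemma compact_unit_cube: "compact unit_cube"
  unfolding unit_cube_def by (intro compact_Times compact_PiE_UNIV compact_Icc)

lemma continuous_on_fst_entry [continuous_intros]:
  "continuous_on X (\<lambda>p::('a, 'b) point. fst p j q)"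
  by (rule continuous_on_product_then_coordinatewise[OF continuous_on_product_then_coordinatewise])
    (rule continuous_on_fst[OF continuous_on_id])

lemma continuous_on_snd_entry [continuous_intros]:
  "continuous_on X (\<lambda>p::('a, 'b) point. snd p q)"
  by (rule continuous_on_product_then_coordinatewise) (rule continuous_on_snd[OF continuous_on_id])

lemma closed_alice_polytope: "closed (alice_polytope n A B)"
proof -
  have eq: "alice_polytope n A B =
     (\<Inter>j\<in>{1..n}. \<Inter>q \<in> PiE {1..j} A \<times> PiE {1..<j} B. {p. 0 \<le> fst p j q}) \<inter>
     (\<Inter>q \<in> UNIV \<times> PiE {1..n} A \<times> PiE {1..n} B. {p. 0 \<le> snd p q}) \<inter>
     {p. (\<Sum>q \<in> PiE {1..1} A \<times> PiE {1..<1} B. fst p 1 q) = 1} \<inter>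
     (\<Inter>j\<in>{2..n}. \<Inter>x \<in> PiE {1..<j} A. \<Inter>y \<in> PiE {1..<j} B.
        {p. (\<Sum>a\<in>A j. fst p j (x(j := a), y)) = fst p (j - 1) (x, y(j - 1 := undefined))}) \<inter>
     (\<Inter>x \<in> PiE {1..n} A. \<Inter>y \<in> PiE {1..n} B.
        {p. (\<Sum>a\<in>UNIV. snd p (a, x, y)) = fst p n (x, y(n := undefined))})"
    unfolding alice_polytope_def by (rule set_eqI) (simp add: case_prod_unfold conj_assoc del: One_nat_def)
  show ?thesis
    unfolding eq
    by (intro closed_Int closed_INT ballI closed_Collect_le closed_Collect_eq continuous_intros)
qed

lemma continuous_on_alice_objective: "continuous_on X (alice_objective n A B \<alpha> \<beta> c)"
  unfolding alice_objective_def fidelity_def case_prod_unfold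
  by (intro continuous_intros)

lemma alice_polytope_nonempty:
  assumes n: "n \<ge> 1" and fin: "\<And>i. i \<in> {1..n} \<Longrightarrow> finite (A i)"
    and x0: "x0 \<in> PiE {1..n} A"
  shows "alice_polytope n A B \<noteq> {}"
proof -
  \<comment> \<open>Alice always sends the letters of \<open>x0\<close> and reveals the bit 0.\<close>
  define \<sigma> :: "nat \<Rightarrow> (nat \<Rightarrow> 'a) \<times> (nat \<Rightarrow> 'b) \<Rightarrow> real"
    where "\<sigma> j = (\<lambda>(x, y). of_bool (x = restrict x0 {1..j}))" for j
  define s :: "bool \<times> (nat \<Rightarrow> 'a) \<times> (nat \<Rightarrow> 'b) \<Rightarrow> real"
    where "s = (\<lambda>(a, x, y). of_bool (\<not> a \<and> x = x0))"
  have "(\<sigma>, s) \<in> alice_polytope n A B"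
  proof (rule alice_polytope_memI)
    have *: "(\<Sum>p \<in> PiE {1..1} A \<times> PiE {1..<1} B. \<sigma> 1 p) =
        (\<Sum>p \<in> PiE {1..1} A \<times> PiE {1..<1} B. if p = (restrict x0 {1..1}, \<lambda>_. undefined) then 1 else 0)"
      by (rule sum.cong) (simp_all add: \<sigma>_def split_paired_all)
    have "restrict x0 {1..1} \<in> PiE {1..1} A" using x0 n by (auto simp: PiE_def Pi_def)
    then show "(\<Sum>p \<in> PiE {1..1} A \<times> PiE {1..<1} B. \<sigma> 1 p) = 1"
      unfolding * using n fin by (subst sum.delta) (auto intro!: finite_PiE)
  next
    fix j x y assume j: "j \<in> {2..n}" and x: "x \<in> PiE {1..<j} A"
    have iff: "x(j := a) = restrict x0 {1..j} \<longleftrightarrow> a = x0 j \<and> x = restrict x0 {1..j - 1}" for a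
    proof
      assume h: "x(j := a) = restrict x0 {1..j}"
      have "x i = restrict x0 {1..j - 1} i" for i
      proof (cases "i = j")
        case True then show ?thesis using x j by (auto simp: PiE_def extensional_def)
      next
        case False then show ?thesis using fun_cong[OF h, of i] j by (auto simp: restrict_def)
      qed
      then have "x = restrict x0 {1..j - 1}" by (rule ext)
      with fun_cong[OF h, of j] j show "a = x0 j \<and> x = restrict x0 {1..j - 1}" by auto
    next
      assume h: "a = x0 j \<and> x = restrict x0 {1..j - 1}"
      show "x(j := a) = restrict x0 {1..j}"
      proof
        show "(x(j := a)) i = restrict x0 {1..j} i" for i
          using h j by (cases "i = j") (auto simp: restrict_def)
      qed
    qed
    have "(\<Sum>a\<in>A j. \<sigma> j (x(j := a), y)) =
        (\<Sum>a\<in>A j. if a = x0 j then of_bool (x = restrict x0 {1..j - 1}) else 0)"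
      unfolding \<sigma>_def prod.case iff by (rule sum.cong) auto
    moreover have "x0 j \<in> A j" using j x0 by auto
    ultimately show "(\<Sum>a\<in>A j. \<sigma> j (x(j := a), y)) = \<sigma> (j - 1) (x, y(j - 1 := undefined))"
      using fin[of j] j by (simp add: \<sigma>_def)
  next
    fix x y assume x: "x \<in> PiE {1..n} A"
    have "restrict x0 {1..n} = x0" using x0 by (auto simp: PiE_restrict)
    then show "(\<Sum>a\<in>UNIV. s (a, x, y)) = \<sigma> n (x, y(n := undefined))"
      by (simp add: s_def \<sigma>_def UNIV_bool)
  qed (auto simp: \<sigma>_def s_def)
  then show ?thesis by auto
qed

text \<open>
  By Tychonoff's theorem the unit cube is compact, also when its index types are infinite; the objective is
  continuous, and clipping shows that the restriction to the cube loses no value.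
\<close>
lemma alice_objective_attains_max:
  assumes n: "n \<ge> 1" and fin: "\<And>i. i \<in> {1..n} \<Longrightarrow> finite (A i)"
    and ne: "PiE {1..n} A \<noteq> {}"
  obtains p where "p \<in> alice_polytope n A B"
    and "\<And>q. q \<in> alice_polytope n A B \<Longrightarrow> alice_objective n A B \<alpha> \<beta> c q \<le> alice_objective n A B \<alpha> \<beta> c p"
proof -
  let ?K = "alice_polytope n A B" let ?f = "alice_objective n A B \<alpha> \<beta> c"
  have clip: "clip_point p \<in> ?K \<and> ?f (clip_point p) = ?f p" if "p \<in> ?K" for p
  proof -
    obtain \<sigma> s where p: "p = (\<sigma>, s)" by (cases p)
    note mem = \<open>p \<in> ?K\<close>[unfolded p]
    note P = alice_polytope_memD[OF mem]
    define \<sigma>' s' where "\<sigma>' = (\<lambda>j q. max 0 (min 1 (\<sigma> j q)))" and "s' = (\<lambda>q. max 0 (min 1 (s q)))"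
    have \<sigma>': "\<sigma>' j (x, y) = \<sigma> j (x, y)"
      if "j \<in> {1..n}" "x \<in> PiE {1..j} A" "y \<in> PiE {1..<j} B" for j x y
      using P(1)[OF that] alice_polytope_le_1(1)[OF n fin mem that] by (simp add: \<sigma>'_def)
    have s': "s' (a, x, y) = s (a, x, y)" if "x \<in> PiE {1..n} A" "y \<in> PiE {1..n} B" for a x y
      using P(2)[OF that] alice_polytope_le_1(2)[OF n fin mem that] by (simp add: s'_def)
    have "(\<sigma>', s') \<in> ?K"
    proof (rule alice_polytope_memI)
      have "(\<Sum>q\<in>PiE {1..1} A \<times> PiE {1..<1} B. \<sigma>' 1 q) = (\<Sum>q\<in>PiE {1..1} A \<times> PiE {1..<1} B. \<sigma> 1 q)"
      proof (rule sum.cong[OF refl], clarify)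
        fix x y assume "x \<in> PiE {1..1} A" "y \<in> PiE {1..<1} B"
        then show "\<sigma>' 1 (x, y) = \<sigma> 1 (x, y)" using n by (intro \<sigma>') auto
      qed
      with P(3) show "(\<Sum>q\<in>PiE {1..1} A \<times> PiE {1..<1} B. \<sigma>' 1 q) = 1" by simp
    next
      fix j x y assume j: "j \<in> {2..n}" and x: "x \<in> PiE {1..<j} A" and y: "y \<in> PiE {1..<j} B"
      have "{1..<j} = {1..j - 1}" using j by auto
      then have "\<sigma>' (j - 1) (x, y(j - 1 := undefined)) = \<sigma> (j - 1) (x, y(j - 1 := undefined))"
        using j x y PiE_remove_last_pred[OF _ y] by (intro \<sigma>') auto
      moreover have "(\<Sum>a\<in>A j. \<sigma>' j (x(j := a), y)) = (\<Sum>a\<in>A j. \<sigma> j (x(j := a), y))"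
        using j y PiE_add_last[OF _ x] by (intro sum.cong refl \<sigma>') auto
      ultimately show "(\<Sum>a\<in>A j. \<sigma>' j (x(j := a), y)) = \<sigma>' (j - 1) (x, y(j - 1 := undefined))"
        using P(4)[OF j x y] by simp
    next
      fix x y assume x: "x \<in> PiE {1..n} A" and y: "y \<in> PiE {1..n} B"
      have "\<sigma>' n (x, y(n := undefined)) = \<sigma> n (x, y(n := undefined))"
        using n x PiE_remove_last[OF y] by (intro \<sigma>') auto
      with P(5)[OF x y] s'[OF x y] show "(\<Sum>a\<in>UNIV. s' (a, x, y)) = \<sigma>' n (x, y(n := undefined))"
        by simp
    qed (auto simp: \<sigma>'_def s'_def)
    moreover have "?f (\<sigma>', s') = ?f (\<sigma>, s)"
      using s' by (simp add: alice_objective_def fidelity_def cong: sum.cong)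
    ultimately show ?thesis by (simp add: p clip_point_def \<sigma>'_def s'_def)
  qed
  obtain x0 where "x0 \<in> PiE {1..n} A" using ne by blast
  from alice_polytope_nonempty[OF n fin this] obtain p0 where "p0 \<in> ?K"
    by (meson ex_in_conv)
  with clip[of p0] clip_point_unit_cube[of p0] have "clip_point p0 \<in> ?K \<inter> unit_cube"
    by simp
  then have "?K \<inter> unit_cube \<noteq> {}" by (metis empty_iff)
  moreover have "compact (?K \<inter> unit_cube)"
    by (intro closed_Int_compact closed_alice_polytope compact_unit_cube)
  ultimately have "\<exists>p \<in> ?K \<inter> unit_cube. \<forall>q \<in> ?K \<inter> unit_cube. ?f q \<le> ?f p"
    by (intro continuous_attains_sup continuous_on_alice_objective)
  then obtain p where p: "p \<in> ?K \<inter> unit_cube" "\<forall>q \<in> ?K \<inter> unit_cube. ?f q \<le> ?f p"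
    by (rule bexE)
  show thesis
  proof (rule that)
    show "p \<in> ?K" using p by simp
    show "?f q \<le> ?f p" if "q \<in> ?K" for q
      using bspec[OF p(2), of "clip_point q"] clip[OF that] clip_point_unit_cube[of q] by simp
  qed
qed

section \<open>Positive semidefinite matrices and channels\<close>

lemma psd_operators: "psd I X \<Longrightarrow> X \<in> operators I"
  by (simp add: psd_def)

lemma operators_outside: "X \<in> operators I \<Longrightarrow> i \<notin> I \<or> j \<notin> I \<Longrightarrow> X i j = 0"
  by (auto simp: operators_def)

lemma psd_quadratic_form:
  assumes "psd I X"
  shows "(\<Sum>i\<in>I. \<Sum>j\<in>I. cnj (v i) * X i j * v j) \<in> \<real>\<^sub>\<ge>\<^sub>0"
  using assms by (simp add: psd_def)

lemma sum_in_nonneg_Reals: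
  fixes f :: "'w \<Rightarrow> complex"
  assumes "\<And>w. w \<in> W \<Longrightarrow> f w \<in> \<real>\<^sub>\<ge>\<^sub>0"
  shows "sum f W \<in> \<real>\<^sub>\<ge>\<^sub>0"
  using assms by (induction W rule: infinite_finite_induct) auto

lemma psd_sum:
  fixes X :: "'w \<Rightarrow> 'i op"
  assumes "\<And>w. w \<in> W \<Longrightarrow> psd I (X w)"
  shows "psd I (\<lambda>i j. \<Sum>w\<in>W. X w i j)"
  unfolding psd_def
proof (intro conjI allI)
  show "(\<lambda>i j. \<Sum>w\<in>W. X w i j) \<in> operators I"
    using assms[THEN psd_operators] by (auto simp: operators_def intro!: sum.neutral)
  fix v :: "'i \<Rightarrow> complex"
  have "(\<Sum>i\<in>I. \<Sum>j\<in>I. cnj (v i) * (\<Sum>w\<in>W. X w i j) * v j)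
      = (\<Sum>i\<in>I. \<Sum>j\<in>I. \<Sum>w\<in>W. cnj (v i) * X w i j * v j)"
    by (simp add: sum_distrib_left sum_distrib_right)
  also have "\<dots> = (\<Sum>i\<in>I. \<Sum>w\<in>W. \<Sum>j\<in>I. cnj (v i) * X w i j * v j)"
    by (intro sum.cong refl sum.swap)
  also have "\<dots> = (\<Sum>w\<in>W. \<Sum>i\<in>I. \<Sum>j\<in>I. cnj (v i) * X w i j * v j)"
    by (rule sum.swap)
  also have "\<dots> \<in> \<real>\<^sub>\<ge>\<^sub>0"
    by (rule sum_in_nonneg_Reals) (rule psd_quadratic_form[OF assms])
  finally show "(\<Sum>i\<in>I. \<Sum>j\<in>I. cnj (v i) * (\<Sum>w\<in>W. X w i j) * v j) \<in> \<real>\<^sub>\<ge>\<^sub>0" .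
qed

text \<open>
  A vector on the new index set is transported along \<open>g\<close> and extended by zero; the quadratic form of \<open>X\<close> at
  the transported vector is the form of the regrouped matrix.
\<close>
lemma psd_regroup:
  fixes X :: "'i op" and g :: "'j \<Rightarrow> 'i"
  assumes X: "psd I X" and fin: "finite I" "finite J" and J': "J' \<subseteq> J"
    and inj: "inj_on g J'" and img: "g ` J' \<subseteq> I"
  shows "psd J (regroup J' g X)"
  unfolding psd_def
proof (intro conjI allI)
  show "regroup J' g X \<in> operators J"
    using J' by (auto simp: operators_def regroup_def)
  fix v :: "'j \<Rightarrow> complex"
  define u where "u i = (if i \<in> g ` J' then v (inv_into J' g i) else 0)" for i
  have u: "u (g p) = v p" if "p \<in> J'" for p
    using that inj by (simp add: u_def)
  have "(\<Sum>i\<in>I. \<Sum>j\<in>I. cnj (u i) * X i j * u j) = (\<Sum>i\<in>g ` J'. \<Sum>j\<in>g ` J'. cnj (u i) * X i j * u j)"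
  proof (rule sum.mono_neutral_cong_right)
    show "\<forall>i\<in>I - g ` J'. (\<Sum>j\<in>I. cnj (u i) * X i j * u j) = 0" by (simp add: u_def)
    show "(\<Sum>j\<in>I. cnj (u i) * X i j * u j) = (\<Sum>j\<in>g ` J'. cnj (u i) * X i j * u j)" for i
      by (rule sum.mono_neutral_right) (use fin img in \<open>auto simp: u_def\<close>)
  qed (use fin img in auto)
  also have "\<dots> = (\<Sum>p\<in>J'. \<Sum>q\<in>J'. cnj (v p) * X (g p) (g q) * v q)"
    by (simp add: sum.reindex[OF inj] u)
  also have "\<dots> = (\<Sum>p\<in>J. \<Sum>q\<in>J. cnj (v p) * regroup J' g X p q * v q)"
  proof (rule sum.mono_neutral_cong_left)
    show "\<forall>p\<in>J - J'. (\<Sum>q\<in>J. cnj (v p) * regroup J' g X p q * v q) = 0"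
      by (simp add: regroup_def)
    show "(\<Sum>q\<in>J'. cnj (v p) * X (g p) (g q) * v q) = (\<Sum>q\<in>J. cnj (v p) * regroup J' g X p q * v q)"
      if "p \<in> J'" for p
      by (rule sum.mono_neutral_cong_left) (use fin J' that in \<open>auto simp: regroup_def\<close>)
  qed (use fin J' in auto)
  finally show "(\<Sum>p\<in>J. \<Sum>q\<in>J. cnj (v p) * regroup J' g X p q * v q) \<in> \<real>\<^sub>\<ge>\<^sub>0"
    using psd_quadratic_form[OF X, of u] by simp
qed

lemma psd_real_two_point:
  assumes X: "psd I X" and fin: "finite I" and pq: "p \<in> I" "q \<in> I" "p \<noteq> q"
  shows "0 \<le> a\<^sup>2 * Re (X p p) + a * b * Re (X p q + X q p) + b\<^sup>2 * Re (X q q)"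
proof -
  define v :: "'a \<Rightarrow> complex" where "v = (\<lambda>i. if i = p then of_real a else if i = q then of_real b else 0)"
  have red: "(\<Sum>i\<in>I. f i) = f p + f q" if "\<And>i. i \<noteq> p \<Longrightarrow> i \<noteq> q \<Longrightarrow> f i = 0" for f :: "'a \<Rightarrow> complex"
  proof -
    have "(\<Sum>i\<in>I. f i) = (\<Sum>i\<in>{p, q}. f i)"
      by (rule sum.mono_neutral_right) (use fin pq that in auto)
    then show ?thesis using pq by simp
  qed
  have "(\<Sum>i\<in>I. \<Sum>j\<in>I. cnj (v i) * X i j * v j)
      = of_real a * X p p * of_real a + of_real a * X p q * of_real b
        + (of_real b * X q p * of_real a + of_real b * X q q * of_real b)"
    using pq by (subst red, simp add: v_def, (subst red, simp add: v_def)+, simp add: v_def)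
  with psd_quadratic_form[OF X, of v]
  have "0 \<le> Re (of_real a * X p p * of_real a + of_real a * X p q * of_real b
        + (of_real b * X q p * of_real a + of_real b * X q q * of_real b))"
    by (simp only: complex_nonneg_Reals_iff)
  then show ?thesis by (simp add: power2_eq_square algebra_simps)
qed

lemma psd_diag_nonneg:
  assumes X: "psd I X" and fin: "finite I"
  shows "0 \<le> Re (X p p)"
proof (cases "p \<in> I")
  case True
  have row: "(\<Sum>j\<in>I. cnj (basis_vec p i) * X i j * basis_vec p j) = cnj (basis_vec p i) * X i p" for i
    by (subst sum.remove[OF fin True]) (simp add: basis_vec_def)
  have "(\<Sum>i\<in>I. \<Sum>j\<in>I. cnj (basis_vec p i) * X i j * basis_vec p j) = X p p"
    unfolding row by (subst sum.remove[OF fin True]) (simp add: basis_vec_def)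
  with psd_quadratic_form[OF X, of "basis_vec p"] show ?thesis
    by (simp add: complex_nonneg_Reals_iff)
qed (use operators_outside[OF psd_operators[OF X]] in auto)

text \<open>
  At real vectors supported on \<open>{p, q}\<close> the quadratic form is a binary real form with middle coefficient
  \<open>Re (X p q + X q p)\<close>; it is nonnegative, hence has no positive discriminant.
\<close>
lemma psd_offdiag_le:
  assumes X: "psd I X" and fin: "finite I"
  shows "Re (X p q + X q p) \<le> 2 * (sqrt (Re (X p p)) * sqrt (Re (X q q)))"
proof -
  let ?P = "Re (X p p)" and ?Q = "Re (X q q)" and ?R = "Re (X p q + X q p)"
  have nn: "0 \<le> ?P" "0 \<le> ?Q" using psd_diag_nonneg[OF X fin] by auto
  consider "p \<notin> I \<or> q \<notin> I" | "p = q" | "p \<in> I" "q \<in> I" "p \<noteq> q" by blast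
  then show ?thesis
  proof cases
    case 1
    then have "X p q = 0" "X q p = 0"
      using operators_outside[OF psd_operators[OF X]] by blast+
    then show ?thesis using nn by simp
  next
    case 2 then show ?thesis using nn by simp
  next
    case 3
    note form = psd_real_two_point[OF X fin 3]
    show ?thesis
    proof (rule ccontr)
      assume *: "\<not> ?thesis"
      have R: "0 < ?R"
      proof -
        have "0 \<le> 2 * (sqrt ?P * sqrt ?Q)" using nn by simp
        with * show ?thesis by linarith
      qed
      show False
      proof (cases "?P = 0 \<or> ?Q = 0")
        case True
        \<comment> \<open>If a diagonal entry vanishes, the form is affine in the coordinate of that entry and would
          be negative far out.\<close>
        then show False
        proof
          assume "?P = 0"
          with form[of "- (?Q + 1) / ?R" 1] R show False by (simp add: field_simps)
        next
          assume "?Q = 0"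
          with form[of 1 "- (?P + 1) / ?R"] R show False by (simp add: field_simps)
        qed
      next
        case False
        \<comment> \<open>The coordinates \<open>sqrt ?Q\<close> and \<open>- sqrt ?P\<close> make the two square terms equal.\<close>
        then have "0 < sqrt ?P * sqrt ?Q" using nn by simp
        moreover have "0 \<le> (sqrt ?P * sqrt ?Q) * (2 * (sqrt ?P * sqrt ?Q) - ?R)"
        proof -
          have "sqrt ?P * sqrt ?P = ?P" "sqrt ?Q * sqrt ?Q = ?Q" using nn by auto
          moreover have "0 \<le> ?Q * ?P - sqrt ?Q * sqrt ?P * ?R + ?P * ?Q"
            using form[of "sqrt ?Q" "- sqrt ?P"] nn by simp
          moreover have "(sqrt ?P * sqrt ?Q) * (2 * (sqrt ?P * sqrt ?Q) - ?R)
              = 2 * (sqrt ?P * sqrt ?P) * (sqrt ?Q * sqrt ?Q) - sqrt ?Q * sqrt ?P * ?R"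
            by (simp only: algebra_simps)
          ultimately show ?thesis by (simp add: algebra_simps)
        qed
        ultimately show False using * by (simp add: zero_le_mult_iff)
      qed
    qed
  qed
qed

text \<open>
  Pairing \<open>(x, z)\<close> with \<open>(z, x)\<close> replaces every entry by its symmetrization, which is at most
  \<open>sqrt (s x) * sqrt (s z)\<close>. With these bounds the double sum is the square that defines the fidelity.
\<close>
lemma psd_fidelity_bound:
  assumes Y: "psd I Y" and fin: "finite I"
    and q: "\<And>x. x \<in> I \<Longrightarrow> 0 \<le> q x" and s: "\<And>x. x \<in> I \<Longrightarrow> Re (Y x x) \<le> s x"
  shows "Re (\<Sum>x\<in>I. \<Sum>z\<in>I. of_real (sqrt (q x) * sqrt (q z)) * Y z x) \<le> fidelity I s q"
proof -
  let ?r = "\<lambda>x z. sqrt (q x) * sqrt (q z)"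
  let ?L = "\<Sum>x\<in>I. \<Sum>z\<in>I. ?r x z * Re (Y z x)"
  have "2 * ?L = ?L + (\<Sum>x\<in>I. \<Sum>z\<in>I. ?r z x * Re (Y x z))"
    by (subst (2) sum.swap) simp
  also have "\<dots> = (\<Sum>x\<in>I. \<Sum>z\<in>I. ?r x z * Re (Y z x + Y x z))"
    by (simp add: sum.distrib algebra_simps)
  also have "\<dots> \<le> (\<Sum>x\<in>I. \<Sum>z\<in>I. ?r x z * (2 * (sqrt (s z) * sqrt (s x))))"
  proof (intro sum_mono mult_left_mono)
    fix x z assume xz: "x \<in> I" "z \<in> I"
    have nn: "0 \<le> Re (Y z z)" "0 \<le> Re (Y x x)" using psd_diag_nonneg[OF Y fin] by auto
    have "Re (Y z x + Y x z) \<le> 2 * (sqrt (Re (Y z z)) * sqrt (Re (Y x x)))"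
      by (rule psd_offdiag_le[OF Y fin])
    also have "\<dots> \<le> 2 * (sqrt (s z) * sqrt (s x))"
      using s[OF xz(1)] s[OF xz(2)] nn by (intro mult_left_mono mult_mono) auto
    finally show "Re (Y z x + Y x z) \<le> 2 * (sqrt (s z) * sqrt (s x))" .
    show "0 \<le> ?r x z" using q xz by simp
  qed
  also have "\<dots> = 2 * fidelity I s q"
    by (simp add: fidelity_def power2_eq_square sum_product sum_distrib_left algebra_simps)
  finally show ?thesis by simp
qed

lemma linear_super_zero:
  assumes "linear_super I J \<Phi>"
  shows "\<Phi> (\<lambda>i j. 0) = (\<lambda>i j. 0)"
proof -
  have zero: "(\<lambda>i j. 0) \<in> operators I" by (simp add: operators_def)
  have "\<forall>c. \<forall>X\<in>operators I. \<Phi> (\<lambda>i j. c * X i j) = (\<lambda>i j. c * \<Phi> X i j)"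
    using assms by (simp add: linear_super_def)
  from bspec[OF spec[OF this, of 0] zero] show ?thesis by simp
qed

lemma super_tensor_id_apply:
  "super_tensor_id \<Phi> X (i, k) (j, l) = \<Phi> (\<lambda>i' j'. X (i', k) (j', l)) i j"
  by (simp add: super_tensor_id_def)

lemma block_operators: "X \<in> operators (I \<times> K) \<Longrightarrow> (\<lambda>i j. X (i, k) (j, l)) \<in> operators I"
  by (auto simp: operators_def)

lemma super_tensor_id_operators:
  assumes lin: "linear_super I J \<Phi>" and X: "X \<in> operators (I \<times> K)"
  shows "super_tensor_id \<Phi> X \<in> operators (J \<times> K)"
proof -
  have "super_tensor_id \<Phi> X (i, k) (j, l) = 0" if "(i, k) \<notin> J \<times> K \<or> (j, l) \<notin> J \<times> K" for i k j l
  proof (cases "k \<in> K \<and> l \<in> K")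
    case True
    have "\<Phi> (\<lambda>i' j'. X (i', k) (j', l)) \<in> operators J"
      using lin block_operators[OF X, of k l] by (auto simp: linear_super_def)
    with True that show ?thesis
      by (auto simp: super_tensor_id_apply operators_def)
  next
    case False
    then have "(\<lambda>i' j'. X (i', k) (j', l)) = (\<lambda>i' j'. 0)"
      by (intro ext operators_outside[OF X]) auto
    then show ?thesis by (simp add: super_tensor_id_apply linear_super_zero[OF lin])
  qed
  then show ?thesis by (auto simp: operators_def)
qed

text \<open>
  Complete positivity, stated for the ancillas \<open>{..<m}\<close>, holds for every finite ancilla, since
  \<open>\<Phi> \<otimes> id\<close> acts blockwise and therefore commutes with an enumeration of the ancilla.
\<close>
lemma quantum_channel_psd:
  fixes \<Phi> :: "'i op \<Rightarrow> 'j op" and X :: "('i \<times> 'k) op"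
  assumes \<Phi>: "quantum_channel I J \<Phi>" and fin: "finite I" "finite J" "finite K"
    and X: "psd (I \<times> K) X"
  shows "psd (J \<times> K) (super_tensor_id \<Phi> X)"
proof -
  have lin: "linear_super I J \<Phi>" using \<Phi> by (simp add: quantum_channel_def)
  note opX = psd_operators[OF X]
  obtain f where f: "bij_betw f {..<card K} K"
    using ex_bij_betw_nat_finite[OF fin(3)] by (auto simp: atLeast0LessThan)
  define g where "g = inv_into {..<card K} f"
  have g: "bij_betw g K {..<card K}" unfolding g_def by (rule bij_betw_inv_into[OF f])
  have fg: "f (g k) = k" if "k \<in> K" for k
    using f that unfolding g_def by (simp add: bij_betw_inv_into_right)
  define X' where "X' = regroup (I \<times> {..<card K}) (map_prod id f) X"
  have "psd (I \<times> {..<card K}) X'"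
    unfolding X'_def
    by (rule psd_regroup[OF X])
      (use fin f in \<open>auto simp: bij_betw_def intro!: map_prod_inj_on\<close>)
  then have psd': "psd (J \<times> {..<card K}) (super_tensor_id \<Phi> X')"
    using \<Phi> by (simp add: quantum_channel_def)
  have block: "(\<lambda>i' j'. X' (i', g k) (j', g l)) = (\<lambda>i' j'. X (i', k) (j', l))"
    if "k \<in> K" "l \<in> K" for k l
  proof (intro ext)
    fix i j
    have "g k < card K" "g l < card K" using g that by (auto simp: bij_betw_def)
    then show "X' (i, g k) (j, g l) = X (i, k) (j, l)"
      using operators_outside[OF opX] that by (auto simp: X'_def regroup_def fg)
  qed
  have "super_tensor_id \<Phi> X = regroup (J \<times> K) (map_prod id g) (super_tensor_id \<Phi> X')"
  proof (intro ext)
    fix p q :: "'j \<times> 'k"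
    obtain i k j l where pq: "p = (i, k)" "q = (j, l)" by (cases p, cases q)
    show "super_tensor_id \<Phi> X p q = regroup (J \<times> K) (map_prod id g) (super_tensor_id \<Phi> X') p q"
      using operators_outside[OF super_tensor_id_operators[OF lin opX]]
      by (auto simp: pq regroup_def super_tensor_id_apply block)
  qed
  moreover have "psd (J \<times> K) (regroup (J \<times> K) (map_prod id g) (super_tensor_id \<Phi> X'))"
    by (rule psd_regroup[OF psd'])
      (use fin g in \<open>auto simp: bij_betw_def intro!: map_prod_inj_on\<close>)
  ultimately show ?thesis by simp
qed

section \<open>Conditioning on the reply register of honest Bob\<close>

text \<open>
  The effect of a round on Alice's side when Bob's reply is known to be the basis element \<open>b\<close>: Bob appends
  the message register to his record, and Alice's next input register is in the state \<open>b\<close>.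
\<close>
definition receive ::
  "(nat \<Rightarrow> 'a set) \<Rightarrow> ('a, 'b) alice_strategy \<Rightarrow> nat \<Rightarrow> 'b \<Rightarrow>
   (('a \<times> nat) \<times> (nat \<Rightarrow> 'a)) op \<Rightarrow> ((nat \<times> 'b) \<times> (nat \<Rightarrow> 'a)) op"
where
  "receive A S i b = regroup (({..<ws_dim S i} \<times> {b}) \<times> PiE {1..i} A)
     (\<lambda>((w, v), x). ((x i, w), x(i := undefined)))"

text \<open>
  The state of Alice and of Bob's record after \<open>k\<close> rounds, when the letters of \<open>y\<close> are sent to Alice.
  It does not involve \<open>\<beta>\<close>, so it is also defined for strings \<open>y\<close> of probability zero.
\<close>
primrec branch_state ::
  "(nat \<Rightarrow> 'a set) \<Rightarrow> ('a, 'b) alice_strategy \<Rightarrow> (nat \<Rightarrow> 'b) \<Rightarrow> nat \<Rightarrow>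
   (('a \<times> nat) \<times> (nat \<Rightarrow> 'a)) op"
where
  "branch_state A S y 0 = op_tensor (init_state S) (rank_one (basis_vec (\<lambda>_. undefined)))"
| "branch_state A S y (Suc k) =
     super_tensor_id (round_op S (Suc k)) (receive A S (Suc k) (y (Suc k)) (branch_state A S y k))"

definition branch_final ::
  "nat \<Rightarrow> (nat \<Rightarrow> 'a set) \<Rightarrow> ('a, 'b) alice_strategy \<Rightarrow> (nat \<Rightarrow> 'b) \<Rightarrow>
   (((bool \<times> (nat \<Rightarrow> 'a)) \<times> nat) \<times> (nat \<Rightarrow> 'a)) op"
where
  "branch_final n A S y =
     super_tensor_id (reveal_op S) (receive A S n (y n) (branch_state A S y (n - 1)))"

lemma valid_strategy_init:
  "valid_strategy n A B S \<Longrightarrow> density_op (A 1 \<times> {..<ws_dim S 1}) (init_state S)"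
  by (simp add: valid_strategy_def)

lemma valid_strategy_round:
  "valid_strategy n A B S \<Longrightarrow> i \<in> {1..<n} \<Longrightarrow>
    quantum_channel ({..<ws_dim S i} \<times> B i) (A (Suc i) \<times> {..<ws_dim S (Suc i)}) (round_op S i)"
  by (simp add: valid_strategy_def)

lemma valid_strategy_reveal:
  "valid_strategy n A B S \<Longrightarrow>
    quantum_channel ({..<ws_dim S n} \<times> B n) ((UNIV \<times> PiE {1..n} A) \<times> {..<ws_dim S (Suc n)}) (reveal_op S)"
  by (simp add: valid_strategy_def)

lemma valid_strategy_meas:
  "valid_strategy n A B S \<Longrightarrow> povm (alice_final_basis n B S) (n_out S) (final_meas S)"
  by (simp add: valid_strategy_def)

lemma quantum_channel_linear: "quantum_channel I J \<Phi> \<Longrightarrow> linear_super I J \<Phi>"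
  by (simp add: quantum_channel_def)

lemma receive_operators:
  "b \<in> B i \<Longrightarrow> receive A S i b X \<in> operators (({..<ws_dim S i} \<times> B i) \<times> PiE {1..i} A)"
  by (auto simp: receive_def regroup_def operators_def)

lemma phi_state_eq:
  assumes fin: "finite (PiE {1..n} B)" and y': "y' \<in> PiE {1..n} B"
  shows "phi_state n B \<beta> (b, b', y, y') =
    (if b' = b \<and> y = y' then of_real (sqrt (\<beta> b y') / sqrt 2) else 0)"
proof -
  have phi: "phi_vec n B \<beta> d (y, y') = (if y = y' then of_real (sqrt (\<beta> d y')) else 0)" for d
  proof -
    have "phi_vec n B \<beta> d (y, y') = (\<Sum>z\<in>PiE {1..n} B. if z = y' then (if y = y' then of_real (sqrt (\<beta> d y')) else 0) else 0)"
      unfolding phi_vec_def prod.case by (rule sum.cong) (auto simp: basis_vec_def)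
    then show ?thesis using fin y' by simp
  qed
  show ?thesis
    unfolding phi_state_def prod.case phi by (cases b; cases b') (auto simp: basis_vec_def UNIV_bool)
qed

text \<open>
  Bob's amplitude is \<open>sqrt (\<beta> b y / 2)\<close> if the copies agree and zero otherwise. The blocks considered here have
  the same \<open>b\<close> and \<open>y\<close> as row and column index, so the square roots multiply to \<open>\<beta> b y / 2\<close>.
\<close>
lemma initial_joint_branch:
  assumes fin: "finite (PiE {1..n} B)" and y: "y \<in> PiE {1..n} B" and \<beta>: "0 \<le> \<beta> b y"
  shows "initial_joint n B \<beta> S (u, (x, b, b', yy, y)) (u', (x', b, b', zz, y)) =
    (if b' = b \<and> yy = restrict y {0<..n} \<and> zz = restrict y {0<..n}
     then of_real (\<beta> b y / 2) * branch_state A S y 0 (u, x) (u', x') else 0)"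
proof -
  have "{0<..n} = {1..n}" by auto
  then have r: "restrict y {0<..n} = y" using y by (simp add: PiE_restrict)
  have "complex_of_real (sqrt (\<beta> b y) / sqrt 2) * cnj (complex_of_real (sqrt (\<beta> b y) / sqrt 2))
      = of_real (\<beta> b y / 2)"
    using \<beta> by (simp flip: of_real_mult)
  then have phi: "phi_state n B \<beta> (b, b', yy, y) * cnj (phi_state n B \<beta> (b, b', zz, y)) =
      (if b' = b \<and> yy = y \<and> zz = y then of_real (\<beta> b y / 2) else 0)"
    by (simp only: phi_state_eq[OF fin y]) simp
  have "initial_joint n B \<beta> S (u, (x, b, b', yy, y)) (u', (x', b, b', zz, y)) =
      branch_state A S y 0 (u, x) (u', x') *
      (phi_state n B \<beta> (b, b', yy, y) * cnj (phi_state n B \<beta> (b, b', zz, y)))"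
    by (simp add: initial_joint_def op_tensor_def rank_one_def)
  then show ?thesis unfolding phi r by simp
qed

text \<open>
  Within the block of \<open>y\<close>, Bob's unsent registers agree with \<open>y\<close> before round \<open>k + 1\<close> exactly if the letter that
  is sent is \<open>y (k + 1)\<close> and the remaining ones agree with \<open>y\<close> afterwards. This is why Alice receives a
  classical letter.
\<close>
lemma update_eq_restrict_iff:
  fixes yy y :: "nat \<Rightarrow> 'b"
  assumes k: "Suc k \<le> n" and yy: "yy \<in> extensional {Suc k<..n}"
  shows "yy(Suc k := v) = restrict y {k<..n} \<longleftrightarrow> v = y (Suc k) \<and> yy = restrict y {Suc k<..n}"
proof
  assume h: "yy(Suc k := v) = restrict y {k<..n}"
  have "yy j = restrict y {Suc k<..n} j" for j
  proof (cases "j = Suc k")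
    case True then show ?thesis using yy by (simp add: extensional_def)
  next
    case False then show ?thesis using fun_cong[OF h, of j] by (simp add: restrict_def)
  qed
  then have "yy = restrict y {Suc k<..n}" by (rule ext)
  moreover have "v = y (Suc k)" using fun_cong[OF h, of "Suc k"] k by simp
  ultimately show "v = y (Suc k) \<and> yy = restrict y {Suc k<..n}" by simp
next
  assume h: "v = y (Suc k) \<and> yy = restrict y {Suc k<..n}"
  show "yy(Suc k := v) = restrict y {k<..n}"
  proof
    show "(yy(Suc k := v)) j = restrict y {k<..n} j" for j
      using h k by (cases "j = Suc k") (auto simp: restrict_def)
  qed
qed

lemma exchange_branch:
  fixes J :: "(('a \<times> nat) \<times> ('a, 'b) bob_regs) op"
  assumes k: "Suc k \<le> n" and y: "y \<in> PiE {1..n} B"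
    and J: "\<And>u u' x x' yy zz. J (u, (x, b, b', yy, y)) (u', (x', b, b', zz, y)) =
      (if b' = b \<and> yy = restrict y {k<..n} \<and> zz = restrict y {k<..n} then r * T (u, x) (u', x') else 0)"
  shows "exchange n A B S (Suc k) J (wv, (x, b, b', yy, y)) (wv', (x', b, b', zz, y)) =
    (if b' = b \<and> yy = restrict y {Suc k<..n} \<and> zz = restrict y {Suc k<..n}
     then r * receive A S (Suc k) (y (Suc k)) T (wv, x) (wv', x') else 0)"
proof -
  obtain w v w' v' where wv: "wv = (w, v)" "wv' = (w', v')" by (cases wv, cases wv')
  have ry: "restrict y {Suc k<..n} \<in> PiE {Suc k<..n} B" using y by (auto simp: PiE_def Pi_def)
  have yk: "y (Suc k) \<in> B (Suc k)" using y k by (auto simp: PiE_def Pi_def)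
  show ?thesis
  proof (cases "yy \<in> PiE {Suc k<..n} B \<and> zz \<in> PiE {Suc k<..n} B")
    case False
    then have 1: "\<not> (b' = b \<and> yy = restrict y {Suc k<..n} \<and> zz = restrict y {Suc k<..n})"
      using ry by auto
    have "exchange n A B S (Suc k) J (wv, (x, b, b', yy, y)) (wv', (x', b, b', zz, y)) = 0"
      unfolding exchange_def regroup_def bob_basis_def by (rule if_not_P) (use False in auto)
    then show ?thesis unfolding if_not_P[OF 1] .
  next
    case True
    then have iff: "yy(Suc k := t) = restrict y {k<..n} \<longleftrightarrow> t = y (Suc k) \<and> yy = restrict y {Suc k<..n}"
      "zz(Suc k := t) = restrict y {k<..n} \<longleftrightarrow> t = y (Suc k) \<and> zz = restrict y {Suc k<..n}" for t
      by - (rule update_eq_restrict_iff[OF k], use True in \<open>simp add: PiE_def\<close>)+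
    let ?in = "w < ws_dim S (Suc k) \<and> v \<in> B (Suc k) \<and> x \<in> PiE {1..Suc k} A \<and>
        w' < ws_dim S (Suc k) \<and> v' \<in> B (Suc k) \<and> x' \<in> PiE {1..Suc k} A"
    have "exchange n A B S (Suc k) J (wv, (x, b, b', yy, y)) (wv', (x', b, b', zz, y)) =
      (if ?in then J ((x (Suc k), w), (x(Suc k := undefined), b, b', yy(Suc k := v), y))
          ((x' (Suc k), w'), (x'(Suc k := undefined), b, b', zz(Suc k := v'), y)) else 0)"
      using True y unfolding exchange_def regroup_def bob_basis_def wv
      by (simp del: fun_upd_apply)
    also have "\<dots> = (if b' = b \<and> yy = restrict y {Suc k<..n} \<and> zz = restrict y {Suc k<..n}
       then r * receive A S (Suc k) (y (Suc k)) T (wv, x) (wv', x') else 0)"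
      unfolding J iff receive_def regroup_def wv using yk by auto
    finally show ?thesis .
  qed
qed

text \<open>
  \<open>\<Phi> \<otimes> id\<close> acts on each block by \<open>\<Phi>\<close> alone, so by linearity it preserves a relation between single blocks of
  two states.
\<close>
lemma super_tensor_id_branch:
  assumes lin: "linear_super I J \<Phi>" and T: "T \<in> operators (I \<times> K)"
    and X: "\<And>i j. X (i, p) (j, q) = (if P then r * T (i, x) (j, x') else 0)"
  shows "super_tensor_id \<Phi> X (u, p) (u', q) = (if P then r * super_tensor_id \<Phi> T (u, x) (u', x') else 0)"
proof (cases P)
  case True
  have "\<forall>c. \<forall>X\<in>operators I. \<Phi> (\<lambda>i j. c * X i j) = (\<lambda>i j. c * \<Phi> X i j)"
    using lin by (simp add: linear_super_def)
  from bspec[OF spec[OF this, of r] block_operators[OF T, of x x']]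
  show ?thesis using True by (simp add: super_tensor_id_apply X)
next
  case False
  then show ?thesis by (simp add: super_tensor_id_apply X linear_super_zero[OF lin])
qed

text \<open>
  The registers \<open>B\<^sub>0\<close> and \<open>B'\<close> are never sent during the rounds, so blocks that are diagonal in them evolve
  independently of each other.
\<close>
lemma joint_state_branch:
  assumes valid: "valid_strategy n A B S"
    and fin: "finite (PiE {1..n} B)" and y: "y \<in> PiE {1..n} B" and \<beta>: "0 \<le> \<beta> b y"
    and k: "k < n"
  shows "joint_state n A B \<beta> S k (u, (x, b, b', yy, y)) (u', (x', b, b', zz, y)) =
    (if b' = b \<and> yy = restrict y {k<..n} \<and> zz = restrict y {k<..n}
     then of_real (\<beta> b y / 2) * branch_state A S y k (u, x) (u', x') else 0)"
  using k
proof (induction k arbitrary: u u' x x' yy zz)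
  case 0
  show ?case
    unfolding joint_state.simps(1) by (rule initial_joint_branch[where A = A and \<beta> = \<beta> and b = b and y = y, OF fin y \<beta>])
next
  case (Suc k)
  have lin: "linear_super ({..<ws_dim S (Suc k)} \<times> B (Suc k)) (A (Suc (Suc k)) \<times> {..<ws_dim S (Suc (Suc k))})
      (round_op S (Suc k))"
    using valid_strategy_round[OF valid, of "Suc k"] Suc.prems by (simp add: quantum_channel_linear)
  have yk: "y (Suc k) \<in> B (Suc k)" using y Suc.prems by (auto simp: PiE_def Pi_def)
  show ?case
    unfolding joint_state.simps(2) branch_state.simps(2)
    by (rule super_tensor_id_branch[OF lin receive_operators[of _ B, OF yk]],
        rule exchange_branch[OF _ y Suc.IH]) (use Suc.prems in auto)
qed

lemma final_joint_branch:
  assumes valid: "valid_strategy n A B S" and n: "1 \<le> n"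
    and fin: "finite (PiE {1..n} B)" and y: "y \<in> PiE {1..n} B" and \<beta>: "0 \<le> \<beta> b y"
    and w: "w < ws_dim S (Suc n)" and x: "x \<in> PiE {1..n} A" and z: "z \<in> PiE {1..n} A"
  shows "final_joint n A B \<beta> S ((w, b', y), (b, a, x, x)) ((w, b', y), (b, a, z, z)) =
    (if b' = b then of_real (\<beta> b y / 2) * branch_final n A S y (((a, x), w), x) (((a, z), w), z) else 0)"
proof -
  obtain k where k: "n = Suc k" using n by (cases n) auto
  have lin: "linear_super ({..<ws_dim S n} \<times> B n) ((UNIV \<times> PiE {1..n} A) \<times> {..<ws_dim S (Suc n)}) (reveal_op S)"
    by (rule quantum_channel_linear[OF valid_strategy_reveal[OF valid]])
  have yn: "y n \<in> B n" using y n by (auto simp: PiE_def Pi_def)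
  have r: "restrict y {n<..n} = (\<lambda>_. undefined)" by (auto simp: restrict_def)
  have "exchange n A B S (Suc k) (joint_state n A B \<beta> S k) (u, (x, b, b', yy, y)) (u', (x', b, b', zz, y)) =
    (if b' = b \<and> yy = restrict y {Suc k<..n} \<and> zz = restrict y {Suc k<..n}
     then of_real (\<beta> b y / 2) * receive A S (Suc k) (y (Suc k)) (branch_state A S y k) (u, x) (u', x')
     else 0)" for u u' x x' yy zz
    by (rule exchange_branch[OF _ y], use k in simp,
        rule joint_state_branch[where \<beta> = \<beta> and b = b and y = y, OF valid fin y \<beta>])
      (use k in simp)
  from this[of _ _ "\<lambda>_. undefined" _ _ "\<lambda>_. undefined"]
  have ex: "exchange n A B S n (joint_state n A B \<beta> S (n - 1))
      (u, (x, b, b', \<lambda>_. undefined, y)) (u', (x', b, b', \<lambda>_. undefined, y)) =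
    (if b' = b then of_real (\<beta> b y / 2) * receive A S n (y n) (branch_state A S y (n - 1)) (u, x) (u', x')
     else 0)" for u u' x x'
    using r by (simp add: k)
  have "final_joint n A B \<beta> S ((w, b', y), (b, a, x, x)) ((w, b', y), (b, a, z, z)) =
      super_tensor_id (reveal_op S) (exchange n A B S n (joint_state n A B \<beta> S (n - 1)))
        (((a, x), w), (x, b, b', \<lambda>_. undefined, y)) (((a, z), w), (z, b, b', \<lambda>_. undefined, y))"
    using w x y z
    by (simp add: final_joint_def regroup_def alice_final_basis_def bob_final_basis_def)
  also have "\<dots> = (if b' = b then of_real (\<beta> b y / 2) * branch_final n A S y (((a, x), w), x) (((a, z), w), z) else 0)"
    unfolding branch_final_def
    by (rule super_tensor_id_branch[OF lin receive_operators[of _ B, OF yn]]) (rule ex)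
  finally show ?thesis .
qed

section \<open>The output probability of honest Bob\<close>

text \<open>
  Alice's measurement effects add up to the identity, so summing over her outcomes traces out her register.
\<close>
lemma trace_povm_tensor:
  assumes fin: "finite P" "finite Q" and M: "povm P m M"
  shows "(\<Sum>k<m. Re (op_trace (P \<times> Q) (op_mult (P \<times> Q) (op_tensor (M k) N) F)))
    = Re (\<Sum>p\<in>P. \<Sum>q\<in>Q. \<Sum>r\<in>Q. N q r * F (p, r) (p, q))"
proof -
  have "(\<Sum>k<m. op_trace (P \<times> Q) (op_mult (P \<times> Q) (op_tensor (M k) N) F))
      = (\<Sum>k<m. \<Sum>p\<in>P. \<Sum>q\<in>Q. \<Sum>p'\<in>P. \<Sum>r\<in>Q. M k p p' * (N q r * F (p', r) (p, q)))"
    by (simp add: op_trace_def op_mult_def op_tensor_def sum.cartesian_product' mult.assoc)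
  also have "\<dots> = (\<Sum>p\<in>P. \<Sum>q\<in>Q. \<Sum>p'\<in>P. \<Sum>r\<in>Q. \<Sum>k<m. M k p p' * (N q r * F (p', r) (p, q)))"
    by (simp only: sum.swap[of _ _ "{..<m}"])
  also have "\<dots> = (\<Sum>p\<in>P. \<Sum>q\<in>Q. \<Sum>p'\<in>P. \<Sum>r\<in>Q. if p' = p then N q r * F (p', r) (p, q) else 0)"
    using M by (intro sum.cong refl) (simp add: povm_def flip: sum_distrib_right)
  also have "\<dots> = (\<Sum>p\<in>P. \<Sum>q\<in>Q. \<Sum>p'\<in>P. if p' = p then \<Sum>r\<in>Q. N q r * F (p', r) (p, q) else 0)"
    by (intro sum.cong refl) simp
  also have "\<dots> = (\<Sum>p\<in>P. \<Sum>q\<in>Q. \<Sum>r\<in>Q. N q r * F (p, r) (p, q))"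
    using fin by (intro sum.cong refl) simp
  finally show ?thesis by (simp flip: Re_sum)
qed

text \<open>
  The vector \<open>e\<^sub>b \<otimes> e\<^sub>a \<otimes> \<psi>\<^sub>a\<close> with \<open>b = (a \<noteq> c)\<close>; Bob's measurement operator for \<open>c\<close> is the sum over \<open>a\<close> of
  the projections onto these vectors.
\<close>
definition accept_vec ::
  "(bool \<Rightarrow> (nat \<Rightarrow> 'a) \<Rightarrow> real) \<Rightarrow> bool \<Rightarrow> bool \<Rightarrow> bool \<times> bool \<times> (nat \<Rightarrow> 'a) \<times> (nat \<Rightarrow> 'a) \<Rightarrow> complex"
where
  "accept_vec \<alpha> c a = (\<lambda>(b, a', x, x'). if b = (a \<noteq> c) \<and> a' = a \<and> x' = x then of_real (sqrt (\<alpha> a x)) else 0)"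

lemma bob_accept_eq:
  assumes fin: "finite (PiE {1..n} A)" and pq: "p \<in> bob_final_basis n A" "q \<in> bob_final_basis n A"
  shows "bob_accept n A \<alpha> c p q = (\<Sum>a\<in>UNIV. accept_vec \<alpha> c a p * cnj (accept_vec \<alpha> c a q))"
proof -
  obtain b a0 x x' where p: "p = (b, a0, x, x')" by (cases p)
  obtain d e z z' where q: "q = (d, e, z, z')" by (cases q)
  have psi: "psi_vec n A \<alpha> a (t, t') = (if t' = t then of_real (sqrt (\<alpha> a t)) else 0)"
    if "t \<in> PiE {1..n} A" for a t t'
  proof -
    have "psi_vec n A \<alpha> a (t, t') = (\<Sum>s\<in>PiE {1..n} A. if s = t then (if t' = t then of_real (sqrt (\<alpha> a t)) else 0) else 0)"
      unfolding psi_vec_def prod.case by (rule sum.cong) (auto simp: basis_vec_def)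
    then show ?thesis using fin that by simp
  qed
  have xz: "x \<in> PiE {1..n} A" "z \<in> PiE {1..n} A"
    using pq by (auto simp: p q bob_final_basis_def)
  show ?thesis
    unfolding bob_accept_def p q op_tensor_def rank_one_def accept_vec_def prod.case psi[OF xz(1)] psi[OF xz(2)]
    by (intro sum.cong refl) (auto simp: basis_vec_def)
qed

lemma sum_accept_vec:
  assumes fin: "finite (PiE {1..n} A)"
  shows "(\<Sum>p\<in>bob_final_basis n A. accept_vec \<alpha> c a p * f p)
    = (\<Sum>x\<in>PiE {1..n} A. of_real (sqrt (\<alpha> a x)) * f (a \<noteq> c, a, x, x))"
    and "(\<Sum>p\<in>bob_final_basis n A. cnj (accept_vec \<alpha> c a p) * f p)
    = (\<Sum>x\<in>PiE {1..n} A. of_real (sqrt (\<alpha> a x)) * f (a \<noteq> c, a, x, x))"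
proof -
  let ?g = "\<lambda>x. (a \<noteq> c, a, x, x)"
  have inj: "inj_on ?g (PiE {1..n} A)" by (auto simp: inj_on_def)
  have red: "(\<Sum>p\<in>bob_final_basis n A. h p) = (\<Sum>x\<in>PiE {1..n} A. h (?g x))"
    if h: "\<And>b a' x x'. \<not> (b = (a \<noteq> c) \<and> a' = a \<and> x' = x) \<Longrightarrow> h (b, a', x, x') = 0"
    for h :: "_ \<Rightarrow> complex"
  proof -
    have "(\<Sum>p\<in>bob_final_basis n A. h p) = (\<Sum>p\<in>?g ` PiE {1..n} A. h p)"
    proof (rule sum.mono_neutral_right)
      show "\<forall>p\<in>bob_final_basis n A - ?g ` PiE {1..n} A. h p = 0"
      proof
        fix p assume p: "p \<in> bob_final_basis n A - ?g ` PiE {1..n} A"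
        obtain b a' x x' where p': "p = (b, a', x, x')" by (cases p)
        have "\<not> (b = (a \<noteq> c) \<and> a' = a \<and> x' = x)"
          using p unfolding p' bob_final_basis_def by blast
        then show "h p = 0" unfolding p' by (rule h)
      qed
      show "?g ` PiE {1..n} A \<subseteq> bob_final_basis n A" unfolding bob_final_basis_def by blast
    qed (use fin in \<open>simp add: bob_final_basis_def\<close>)
    then show ?thesis unfolding sum.reindex[OF inj] o_def .
  qed
  show "(\<Sum>p\<in>bob_final_basis n A. accept_vec \<alpha> c a p * f p)
    = (\<Sum>x\<in>PiE {1..n} A. of_real (sqrt (\<alpha> a x)) * f (a \<noteq> c, a, x, x))"
    by (subst red) (auto simp: accept_vec_def)
  show "(\<Sum>p\<in>bob_final_basis n A. cnj (accept_vec \<alpha> c a p) * f p)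
    = (\<Sum>x\<in>PiE {1..n} A. of_real (sqrt (\<alpha> a x)) * f (a \<noteq> c, a, x, x))"
    by (subst red) (auto simp: accept_vec_def)
qed

text \<open>
  Alice's registers are traced out, and the vector \<open>accept_vec \<alpha> c a\<close> fixes \<open>b = (a \<noteq> c)\<close>, forces \<open>A\<close> and \<open>A'\<close> to
  agree and weighs \<open>x\<close> with \<open>sqrt (\<alpha> a x)\<close>; the blocks that remain are those of \<open>final_joint_branch\<close>.
\<close>
lemma bob_output_prob_eq:
  assumes n: "1 \<le> n" and valid: "valid_strategy n A B S"
    and fin: "finite (PiE {1..n} A)" "finite (PiE {1..n} B)"
    and \<beta>: "\<And>b y. y \<in> PiE {1..n} B \<Longrightarrow> 0 \<le> \<beta> b y"
  shows "bob_output_prob n A B \<alpha> \<beta> S c =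
    (\<Sum>a\<in>UNIV. \<Sum>y\<in>PiE {1..n} B. \<beta> (a \<noteq> c) y / 2 *
      Re (\<Sum>x\<in>PiE {1..n} A. \<Sum>z\<in>PiE {1..n} A. of_real (sqrt (\<alpha> a x) * sqrt (\<alpha> a z)) *
        (\<Sum>w<ws_dim S (Suc n). branch_final n A S y (((a, z), w), z) (((a, x), w), x))))"
proof -
  let ?P = "alice_final_basis n B S" and ?Q = "bob_final_basis n A"
  let ?F = "final_joint n A B \<beta> S" and ?X = "PiE {1..n} A" and ?Y = "PiE {1..n} B"
  let ?v = "accept_vec \<alpha> c" and ?W = "{..<ws_dim S (Suc n)}"
  let ?r = "\<lambda>a x. complex_of_real (sqrt (\<alpha> a x))"
  let ?T = "\<lambda>y a w x z. branch_final n A S y (((a, z), w), z) (((a, x), w), x)"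
  have Re_scale: "Re (of_real r * z) = r * Re z" for r z by simp
  have finP: "finite ?P" using fin by (simp add: alice_final_basis_def)
  have finQ: "finite ?Q" using fin by (simp add: bob_final_basis_def)
  have inner: "(\<Sum>q\<in>?Q. \<Sum>r\<in>?Q. bob_accept n A \<alpha> c q r * ?F (p, r) (p, q)) =
      (\<Sum>a\<in>UNIV. \<Sum>x\<in>?X. \<Sum>z\<in>?X. ?r a x * ?r a z * ?F (p, (a \<noteq> c, a, z, z)) (p, (a \<noteq> c, a, x, x)))" for p
  proof -
    have "(\<Sum>q\<in>?Q. \<Sum>r\<in>?Q. bob_accept n A \<alpha> c q r * ?F (p, r) (p, q)) =
        (\<Sum>q\<in>?Q. \<Sum>r\<in>?Q. \<Sum>a\<in>UNIV. ?v a q * (cnj (?v a r) * ?F (p, r) (p, q)))"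
      by (intro sum.cong refl) (simp add: bob_accept_eq[OF fin(1)] sum_distrib_right mult.assoc)
    also have "\<dots> = (\<Sum>a\<in>UNIV. \<Sum>q\<in>?Q. \<Sum>r\<in>?Q. ?v a q * (cnj (?v a r) * ?F (p, r) (p, q)))"
      by (simp only: sum.swap[of _ UNIV])
    also have "\<dots> = (\<Sum>a\<in>UNIV. \<Sum>q\<in>?Q. ?v a q * (\<Sum>r\<in>?Q. cnj (?v a r) * ?F (p, r) (p, q)))"
      by (simp only: sum_distrib_left)
    also have "\<dots> = (\<Sum>a\<in>UNIV. \<Sum>x\<in>?X. ?r a x * (\<Sum>z\<in>?X. ?r a z * ?F (p, (a \<noteq> c, a, z, z)) (p, (a \<noteq> c, a, x, x))))"
      by (simp only: sum_accept_vec[OF fin(1)])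
    also have "\<dots> = (\<Sum>a\<in>UNIV. \<Sum>x\<in>?X. \<Sum>z\<in>?X. ?r a x * ?r a z * ?F (p, (a \<noteq> c, a, z, z)) (p, (a \<noteq> c, a, x, x)))"
      by (simp only: sum_distrib_left mult.assoc)
    finally show ?thesis .
  qed
  have F: "?F ((w, b', y), (a \<noteq> c, a, z, z)) ((w, b', y), (a \<noteq> c, a, x, x)) =
      (if b' = (a \<noteq> c) then of_real (\<beta> (a \<noteq> c) y / 2) * ?T y a w x z else 0)"
    if "w \<in> ?W" "y \<in> ?Y" "x \<in> ?X" "z \<in> ?X" for w b' y a z x
    using that by (intro final_joint_branch[OF valid n fin(2)]) (auto simp: \<beta>)
  have "bob_output_prob n A B \<alpha> \<beta> S c
      = Re (\<Sum>p\<in>?P. \<Sum>q\<in>?Q. \<Sum>r\<in>?Q. bob_accept n A \<alpha> c q r * ?F (p, r) (p, q))"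
    unfolding bob_output_prob_def Let_def
    by (rule trace_povm_tensor[OF finP finQ valid_strategy_meas[OF valid]])
  also have "(\<Sum>p\<in>?P. \<Sum>q\<in>?Q. \<Sum>r\<in>?Q. bob_accept n A \<alpha> c q r * ?F (p, r) (p, q)) =
      (\<Sum>p\<in>?P. \<Sum>a\<in>UNIV. \<Sum>x\<in>?X. \<Sum>z\<in>?X. ?r a x * ?r a z * ?F (p, (a \<noteq> c, a, z, z)) (p, (a \<noteq> c, a, x, x)))"
    by (simp only: inner)
  also have "\<dots> = (\<Sum>w\<in>?W. \<Sum>b'\<in>UNIV. \<Sum>y\<in>?Y. \<Sum>a\<in>UNIV. \<Sum>x\<in>?X. \<Sum>z\<in>?X.
      ?r a x * ?r a z * ?F ((w, b', y), (a \<noteq> c, a, z, z)) ((w, b', y), (a \<noteq> c, a, x, x)))"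
    by (simp only: alice_final_basis_def sum.cartesian_product')
  also have "\<dots> = (\<Sum>w\<in>?W. \<Sum>b'\<in>UNIV. \<Sum>y\<in>?Y. \<Sum>a\<in>UNIV. \<Sum>x\<in>?X. \<Sum>z\<in>?X.
      if b' = (a \<noteq> c) then of_real (\<beta> (a \<noteq> c) y / 2) * (?r a x * ?r a z * ?T y a w x z) else 0)"
    by (intro sum.cong refl) (subst F, assumption+, cases c, auto)
  also have "\<dots> = (\<Sum>w\<in>?W. \<Sum>y\<in>?Y. \<Sum>a\<in>UNIV. \<Sum>x\<in>?X. \<Sum>z\<in>?X. \<Sum>b'\<in>UNIV.
      if b' = (a \<noteq> c) then of_real (\<beta> (a \<noteq> c) y / 2) * (?r a x * ?r a z * ?T y a w x z) else 0)"
    (* Each swap moves the sum over b' one place inwards. *)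
    by (rule sum.cong[OF refl], (rule trans[OF sum.swap], rule sum.cong[OF refl])+, rule refl)
  also have "\<dots> = (\<Sum>w\<in>?W. \<Sum>y\<in>?Y. \<Sum>a\<in>UNIV. \<Sum>x\<in>?X. \<Sum>z\<in>?X.
      of_real (\<beta> (a \<noteq> c) y / 2) * (?r a x * ?r a z * ?T y a w x z))"
    by simp
  also have "\<dots> = (\<Sum>w\<in>?W. \<Sum>a\<in>UNIV. \<Sum>y\<in>?Y. \<Sum>x\<in>?X. \<Sum>z\<in>?X.
      of_real (\<beta> (a \<noteq> c) y / 2) * (?r a x * ?r a z * ?T y a w x z))"
    by (rule sum.cong[OF refl], rule sum.swap)
  also have "\<dots> = (\<Sum>a\<in>UNIV. \<Sum>y\<in>?Y. \<Sum>x\<in>?X. \<Sum>z\<in>?X. \<Sum>w\<in>?W.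
      of_real (\<beta> (a \<noteq> c) y / 2) * (?r a x * ?r a z * ?T y a w x z))"
    by ((rule trans[OF sum.swap], rule sum.cong[OF refl])+, rule refl)
  also have "\<dots> = (\<Sum>a\<in>UNIV. \<Sum>y\<in>?Y. of_real (\<beta> (a \<noteq> c) y / 2) *
      (\<Sum>x\<in>?X. \<Sum>z\<in>?X. of_real (sqrt (\<alpha> a x) * sqrt (\<alpha> a z)) * (\<Sum>w\<in>?W. ?T y a w x z)))"
    by (simp only: sum_distrib_left of_real_mult)
  finally show ?thesis
    by (simp only: Re_sum Re_scale)
qed

section \<open>Every strategy is dominated by a point of the polytope\<close>

text \<open>
  Causality: after \<open>k\<close> rounds only the first \<open>k\<close> replies have reached Alice.
\<close>
lemma branch_state_cong:
  assumes "\<And>i. i \<in> {1..k} \<Longrightarrow> y i = y' i"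
  shows "branch_state A S y k = branch_state A S y' k"
  using assms
proof (induction k)
  case (Suc k)
  then have "branch_state A S y k = branch_state A S y' k" "y (Suc k) = y' (Suc k)" by auto
  then show ?case by simp
qed simp

lemma quantum_channel_trace_block:
  assumes \<Phi>: "quantum_channel I J \<Phi>" and X: "X \<in> operators (I \<times> K)"
  shows "(\<Sum>j\<in>J. super_tensor_id \<Phi> X (j, x) (j, x)) = (\<Sum>i\<in>I. X (i, x) (i, x))"
proof -
  have "\<forall>X\<in>operators I. op_trace J (\<Phi> X) = op_trace I X"
    using \<Phi> by (simp add: quantum_channel_def)
  from bspec[OF this block_operators[OF X, of x x]]
  show ?thesis by (simp add: op_trace_def super_tensor_id_apply)
qed

lemma receive_trace:
  assumes b: "b \<in> B i" and fin: "finite (B i)" and x: "x \<in> PiE {1..i} A"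
  shows "(\<Sum>p\<in>{..<ws_dim S i} \<times> B i. receive A S i b X (p, x) (p, x))
    = (\<Sum>w<ws_dim S i. X ((x i, w), x(i := undefined)) ((x i, w), x(i := undefined)))"
proof -
  have "(\<Sum>p\<in>{..<ws_dim S i} \<times> B i. receive A S i b X (p, x) (p, x))
    = (\<Sum>w<ws_dim S i. \<Sum>v\<in>B i. receive A S i b X ((w, v), x) ((w, v), x))"
    by (simp only: sum.cartesian_product')
  also have "\<dots> = (\<Sum>w<ws_dim S i. \<Sum>v\<in>B i. if v = b
      then X ((x i, w), x(i := undefined)) ((x i, w), x(i := undefined)) else 0)"
    by (intro sum.cong refl) (use x in \<open>simp add: receive_def regroup_def\<close>)
  finally show ?thesis using b fin by simp
qed

lemma receive_psd:
  assumes X: "psd ((A i \<times> {..<ws_dim S i}) \<times> PiE {1..<i} A) X" and b: "b \<in> B i"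
    and i: "1 \<le> i" and fin: "finite (B i)" "\<And>j. j \<in> {1..i} \<Longrightarrow> finite (A j)"
  shows "psd (({..<ws_dim S i} \<times> B i) \<times> PiE {1..i} A) (receive A S i b X)"
  unfolding receive_def
proof (rule psd_regroup[OF X])
  have "finite (PiE {1..<i} A)" "finite (PiE {1..i} A)"
    using fin(2) by (auto intro!: finite_PiE)
  then show "finite ((A i \<times> {..<ws_dim S i}) \<times> PiE {1..<i} A)"
    "finite (({..<ws_dim S i} \<times> B i) \<times> PiE {1..i} A)"
    using fin i by auto
  show "({..<ws_dim S i} \<times> {b}) \<times> PiE {1..i} A \<subseteq> ({..<ws_dim S i} \<times> B i) \<times> PiE {1..i} A"
    using b by auto
  have "x = x'" if "x i = x' i" "x(i := undefined) = x'(i := undefined)" for x x' :: "nat \<Rightarrow> 'a"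
  proof
    show "x j = x' j" for j
      using that(1) fun_cong[OF that(2), of j] by (cases "j = i") auto
  qed
  note separates = this
  show "inj_on (\<lambda>((w, v), x). ((x i, w), x(i := undefined))) (({..<ws_dim S i} \<times> {b}) \<times> PiE {1..i} A)"
    (is "inj_on ?g ?J")
  proof (rule inj_onI)
    fix p q assume p: "p \<in> ?J" and q: "q \<in> ?J" and eq: "?g p = ?g q"
    obtain w v x w' v' x' where pq: "p = ((w, v), x)" "q = ((w', v'), x')"
      by (cases p, cases q) auto
    have "x = x'" by (rule separates) (use eq in \<open>simp_all add: pq del: fun_upd_apply\<close>)
    then show "p = q" using p q eq by (simp add: pq)
  qed
  show "(\<lambda>((w, v), x). ((x i, w), x(i := undefined))) ` (({..<ws_dim S i} \<times> {b}) \<times> PiE {1..i} A)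
      \<subseteq> (A i \<times> {..<ws_dim S i}) \<times> PiE {1..<i} A"
    using PiE_remove_last[of _ i A] i by (force simp del: fun_upd_apply)
qed

context
  fixes n :: nat and A :: "nat \<Rightarrow> 'a set" and B :: "nat \<Rightarrow> 'b set"
    and S :: "('a, 'b) alice_strategy"
  assumes n: "1 \<le> n" and finA: "\<And>i. i \<in> {1..n} \<Longrightarrow> finite (A i)"
    and finB: "\<And>i. i \<in> {1..n} \<Longrightarrow> finite (B i)"
    and valid: "valid_strategy n A B S"
begin

lemma branch_state_psd:
  assumes "k < n" and "\<And>i. i \<in> {1..k} \<Longrightarrow> y i \<in> B i"
  shows "psd ((A (Suc k) \<times> {..<ws_dim S (Suc k)}) \<times> PiE {1..<Suc k} A) (branch_state A S y k)"
  using assms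
proof (induction k)
  case 0
  let ?J = "(A 1 \<times> {..<ws_dim S 1}) \<times> {\<lambda>_. undefined}"
  have init: "psd (A 1 \<times> {..<ws_dim S 1}) (init_state S)"
    using valid_strategy_init[OF valid] by (simp add: density_op_def)
  have "branch_state A S y 0 = regroup ?J fst (init_state S)"
  proof (intro ext)
    fix p q :: "('a \<times> nat) \<times> (nat \<Rightarrow> 'a)"
    show "branch_state A S y 0 p q = regroup ?J fst (init_state S) p q"
      using operators_outside[OF psd_operators[OF init], of "fst p" "fst q"]
      by (cases p; cases q) (auto simp: regroup_def op_tensor_def rank_one_def basis_vec_def)
  qed
  moreover have "psd ?J (regroup ?J fst (init_state S))"
    by (rule psd_regroup[OF init]) (use finA[of 1] n in \<open>auto simp: inj_on_def\<close>)
  ultimately show ?case by simp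
next
  case (Suc k)
  have IH: "psd ((A (Suc k) \<times> {..<ws_dim S (Suc k)}) \<times> PiE {1..<Suc k} A) (branch_state A S y k)"
    by (rule Suc.IH) (use Suc.prems in auto)
  have yk: "y (Suc k) \<in> B (Suc k)" using Suc.prems by auto
  have fin: "finite (PiE {1..Suc k} A)" using finA Suc.prems by (auto intro!: finite_PiE)
  have "psd (({..<ws_dim S (Suc k)} \<times> B (Suc k)) \<times> PiE {1..Suc k} A)
      (receive A S (Suc k) (y (Suc k)) (branch_state A S y k))"
    by (rule receive_psd[where B = B and i = "Suc k" and A = A and S = S, OF IH yk]) (use finA finB Suc.prems in auto)
  from quantum_channel_psd[OF valid_strategy_round[OF valid, of "Suc k"] _ _ fin this]
  have "psd ((A (Suc (Suc k)) \<times> {..<ws_dim S (Suc (Suc k))}) \<times> PiE {1..Suc k} A) (branch_state A S y (Suc k))"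
    using finA finB Suc.prems by simp
  then show ?case by (simp add: atLeastLessThanSuc_atLeastAtMost)
qed

lemma branch_final_psd:
  assumes y: "y \<in> PiE {1..n} B"
  shows "psd (((UNIV \<times> PiE {1..n} A) \<times> {..<ws_dim S (Suc n)}) \<times> PiE {1..n} A) (branch_final n A S y)"
proof -
  have yi: "y i \<in> B i" if "i \<in> {1..n - 1}" for i
    by (rule PiE_mem[OF y]) (use that n in auto)
  have yn: "y n \<in> B n" using y n by auto
  have fin: "finite (PiE {1..n} A)" using finA by (auto intro!: finite_PiE)
  have "psd ((A n \<times> {..<ws_dim S n}) \<times> PiE {1..<n} A) (branch_state A S y (n - 1))"
    using branch_state_psd[of "n - 1" y, OF _ yi] n by simp
  then have "psd (({..<ws_dim S n} \<times> B n) \<times> PiE {1..n} A) (receive A S n (y n) (branch_state A S y (n - 1)))"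
    by (rule receive_psd[where B = B and i = n]) (use finA finB yn n in auto)
  from quantum_channel_psd[OF valid_strategy_reveal[OF valid] _ _ fin this]
  show ?thesis using fin finB[of n] n by (simp add: branch_final_def)
qed

text \<open>
  The distribution of Bob's record \<open>A\<^sub>1, \<dots>, A\<^sub>j\<close> in the branch of \<open>y\<close>: the message that has just been prepared
  is joined to the record, and the workspace is summed out.
\<close>
definition branch_sigma :: "nat \<Rightarrow> (nat \<Rightarrow> 'a) \<times> (nat \<Rightarrow> 'b) \<Rightarrow> real" where
  "branch_sigma j = (\<lambda>(x, y). \<Sum>w<ws_dim S j.
     Re (branch_state A S y (j - 1) ((x j, w), x(j := undefined)) ((x j, w), x(j := undefined))))"

text \<open>
  The distribution of \<open>A\<^sub>0', A\<close> at the end. Summing over all values \<open>x'\<close> of \<open>A'\<close>, and not only over \<open>x' = x\<close>, is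
  what makes the last constraint of the polytope an equality.
\<close>
definition branch_reveal :: "bool \<times> (nat \<Rightarrow> 'a) \<times> (nat \<Rightarrow> 'b) \<Rightarrow> real" where
  "branch_reveal = (\<lambda>(a, x, y). \<Sum>x'\<in>PiE {1..n} A. \<Sum>w<ws_dim S (Suc n).
     Re (branch_final n A S y (((a, x'), w), x) (((a, x'), w), x)))"

text \<open>
  Each constraint says that the trace of a diagonal block of the state is preserved by Alice's channel; the
  right-hand side ignores the last reply by \<open>branch_state_cong\<close>.
\<close>
lemma branch_point_in_polytope: "(branch_sigma, branch_reveal) \<in> alice_polytope n A B"
proof (rule alice_polytope_memI)
  fix j x y assume j: "j \<in> {1..n}" and y: "y \<in> PiE {1..<j} B"
  have yi: "y i \<in> B i" if "i \<in> {1..j - 1}" for i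
    by (rule PiE_mem[OF y]) (use that j in auto)
  have psd: "psd ((A j \<times> {..<ws_dim S j}) \<times> PiE {1..<j} A) (branch_state A S y (j - 1))"
    using branch_state_psd[of "j - 1" y, OF _ yi] j by (cases j) auto
  have "finite (PiE {1..<j} A)" using finA j by (auto intro!: finite_PiE)
  then have "finite ((A j \<times> {..<ws_dim S j}) \<times> PiE {1..<j} A)" using finA[OF j] by simp
  from psd_diag_nonneg[OF psd this] show "0 \<le> branch_sigma j (x, y)"
    by (auto simp: branch_sigma_def intro!: sum_nonneg)
next
  fix a x y assume y: "y \<in> PiE {1..n} B"
  have "finite (PiE {1..n} A)" using finA by (auto intro!: finite_PiE)
  then have "finite (((UNIV :: bool set) \<times> PiE {1..n} A) \<times> {..<ws_dim S (Suc n)} )" by simp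
  then have "finite ((((UNIV :: bool set) \<times> PiE {1..n} A) \<times> {..<ws_dim S (Suc n)}) \<times> PiE {1..n} A)"
    using \<open>finite (PiE {1..n} A)\<close> by simp
  from psd_diag_nonneg[OF branch_final_psd[OF y] this] show "0 \<le> branch_reveal (a, x, y)"
    by (auto simp: branch_reveal_def intro!: sum_nonneg)
next
  have upd: "x(1 := undefined) = (\<lambda>_. undefined)" if "x \<in> PiE {1..1} A" for x
  proof
    show "(x(1 := undefined)) j = undefined" for j using that by (cases "j = 1") (auto simp: PiE_def extensional_def)
  qed
  have "(\<Sum>p\<in>PiE {1..1} A \<times> PiE {1..<1} B. branch_sigma 1 p)
      = (\<Sum>x\<in>PiE {1..1} A. \<Sum>w<ws_dim S 1. Re (init_state S (x 1, w) (x 1, w)))"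
    by (simp only: sum.cartesian_product' branch_sigma_def prod.case)
      (intro sum.cong refl, simp add: upd[simplified] op_tensor_def rank_one_def basis_vec_def)
  also have "\<dots> = (\<Sum>a\<in>A 1. \<Sum>w<ws_dim S 1. Re (init_state S (a, w) (a, w)))"
    by (rule sum.reindex_bij_witness[where i = "\<lambda>a. (\<lambda>_. undefined)(1 := a)" and j = "\<lambda>x. x 1"])
      (auto simp: PiE_def extensional_def)
  also have "\<dots> = Re (op_trace (A 1 \<times> {..<ws_dim S 1}) (init_state S))"
    by (simp only: op_trace_def sum.cartesian_product' Re_sum)
  also have "\<dots> = 1" using valid_strategy_init[OF valid] by (simp add: density_op_def)
  finally show "(\<Sum>p\<in>PiE {1..1} A \<times> PiE {1..<1} B. branch_sigma 1 p) = 1" .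
next
  fix j x y assume j: "j \<in> {2..n}" and x: "x \<in> PiE {1..<j} A" and y: "y \<in> PiE {1..<j} B"
  define k where "k = j - 2"
  have jk: "j = Suc (Suc k)" "k < n" "Suc k \<in> {1..<n}" using j by (auto simp: k_def)
  have upd: "(x(j := a))(j := undefined) = x" for a
    using x by (auto simp: PiE_def extensional_def)
  have x': "x \<in> PiE {1..Suc k} A" using x by (simp add: jk atLeastLessThanSuc_atLeastAtMost)
  have yk: "y (Suc k) \<in> B (Suc k)" using y by (auto simp: jk PiE_def Pi_def)
  have "(\<Sum>a\<in>A j. branch_sigma j (x(j := a), y))
      = Re (\<Sum>p\<in>A j \<times> {..<ws_dim S j}. branch_state A S y (Suc k) (p, x) (p, x))"
    by (simp only: branch_sigma_def prod.case upd fun_upd_same sum.cartesian_product' Re_sum)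
      (simp add: jk)
  also have "\<dots> = Re (\<Sum>p\<in>{..<ws_dim S (Suc k)} \<times> B (Suc k).
      receive A S (Suc k) (y (Suc k)) (branch_state A S y k) (p, x) (p, x))"
    using quantum_channel_trace_block[OF valid_strategy_round[OF valid jk(3)] receive_operators[of _ B, OF yk]]
    by (simp add: jk(1))
  also have "\<dots> = branch_sigma (Suc k) (x, y)"
    using finB[of "Suc k"] jk(3) by (simp add: receive_trace[of _ B, OF yk _ x'] branch_sigma_def)
  also have "\<dots> = branch_sigma (Suc k) (x, y(Suc k := undefined))"
    unfolding branch_sigma_def prod.case
    by (intro sum.cong refl arg_cong[where f = Re] fun_cong[OF fun_cong[OF branch_state_cong]]) auto
  finally show "(\<Sum>a\<in>A j. branch_sigma j (x(j := a), y)) = branch_sigma (j - 1) (x, y(j - 1 := undefined))"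
    by (simp add: jk)
next
  fix x y assume x: "x \<in> PiE {1..n} A" and y: "y \<in> PiE {1..n} B"
  have yn: "y n \<in> B n" using y n by auto
  have "(\<Sum>a\<in>UNIV. branch_reveal (a, x, y))
      = Re (\<Sum>p\<in>(UNIV \<times> PiE {1..n} A) \<times> {..<ws_dim S (Suc n)}. branch_final n A S y (p, x) (p, x))"
    by (simp only: branch_reveal_def prod.case sum.cartesian_product' Re_sum)
  also have "\<dots> = Re (\<Sum>p\<in>{..<ws_dim S n} \<times> B n.
      receive A S n (y n) (branch_state A S y (n - 1)) (p, x) (p, x))"
    unfolding branch_final_def
    by (subst quantum_channel_trace_block[OF valid_strategy_reveal[OF valid] receive_operators[of _ B, OF yn]]) simp
  also have "\<dots> = branch_sigma n (x, y)"
    using finB[of n] n by (simp add: receive_trace[of _ B, OF yn _ x] branch_sigma_def)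
  also have "\<dots> = branch_sigma n (x, y(n := undefined))"
    unfolding branch_sigma_def prod.case using n
    by (intro sum.cong refl arg_cong[where f = Re] fun_cong[OF fun_cong[OF branch_state_cong]]) auto
  finally show "(\<Sum>a\<in>UNIV. branch_reveal (a, x, y)) = branch_sigma n (x, y(n := undefined))" .
qed

text \<open>
  The matrix indexed by \<open>x\<close>, in which \<open>A\<close> and \<open>A'\<close> are both equal to \<open>x\<close> and the workspace is traced out, is a sum of
  compressions of a positive semidefinite matrix. Its diagonal entry at \<open>x\<close> is the term \<open>x' = x\<close> of
  \<open>branch_reveal\<close>.
\<close>
lemma branch_fidelity_bound:
  assumes y: "y \<in> PiE {1..n} B" and \<alpha>: "\<And>x. x \<in> PiE {1..n} A \<Longrightarrow> 0 \<le> \<alpha> x"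
  shows "Re (\<Sum>x\<in>PiE {1..n} A. \<Sum>z\<in>PiE {1..n} A. of_real (sqrt (\<alpha> x) * sqrt (\<alpha> z)) *
        (\<Sum>w<ws_dim S (Suc n). branch_final n A S y (((a, z), w), z) (((a, x), w), x)))
    \<le> fidelity (PiE {1..n} A) (\<lambda>x. branch_reveal (a, x, y)) \<alpha>"
proof -
  let ?X = "PiE {1..n} A" and ?W = "{..<ws_dim S (Suc n)}"
  define Y where "Y = (\<lambda>z x. \<Sum>w\<in>?W. regroup ?X (\<lambda>x. (((a, x), w), x)) (branch_final n A S y) z x)"
  have fin: "finite ?X" using finA by (auto intro!: finite_PiE)
  have finI: "finite (((UNIV :: bool set) \<times> ?X) \<times> ?W)" using fin by simp
  then have finI': "finite ((((UNIV :: bool set) \<times> ?X) \<times> ?W) \<times> ?X)" using fin by simp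
  have "psd ?X (regroup ?X (\<lambda>x. (((a, x), w), x)) (branch_final n A S y))" if "w \<in> ?W" for w
    by (rule psd_regroup[OF branch_final_psd[OF y] finI' fin]) (use that in \<open>auto simp: inj_on_def\<close>)
  then have psd: "psd ?X Y" unfolding Y_def by (rule psd_sum)
  have Y: "(\<Sum>w\<in>?W. branch_final n A S y (((a, z), w), z) (((a, x), w), x)) = Y z x"
    if "x \<in> ?X" "z \<in> ?X" for x z
    using that by (simp add: Y_def regroup_def)
  have diag: "Re (Y x x) \<le> branch_reveal (a, x, y)" if x: "x \<in> ?X" for x
  proof -
    let ?f = "\<lambda>x'. \<Sum>w\<in>?W. Re (branch_final n A S y (((a, x'), w), x) (((a, x'), w), x))"
    have "Re (Y x x) = ?f x" unfolding Y[OF x x, symmetric] Re_sum ..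
    also have "\<dots> \<le> (\<Sum>x'\<in>?X. ?f x')"
      by (rule member_le_sum[OF x])
        (use fin psd_diag_nonneg[OF branch_final_psd[OF y] finI'] in \<open>auto intro!: sum_nonneg\<close>)
    finally show ?thesis by (simp add: branch_reveal_def)
  qed
  have "Re (\<Sum>x\<in>?X. \<Sum>z\<in>?X. of_real (sqrt (\<alpha> x) * sqrt (\<alpha> z)) * Y z x)
      \<le> fidelity ?X (\<lambda>x. branch_reveal (a, x, y)) \<alpha>"
    by (rule psd_fidelity_bound[OF psd fin \<alpha> diag])
  moreover have "(\<Sum>x\<in>?X. \<Sum>z\<in>?X. of_real (sqrt (\<alpha> x) * sqrt (\<alpha> z)) *
        (\<Sum>w\<in>?W. branch_final n A S y (((a, z), w), z) (((a, x), w), x))) =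
      (\<Sum>x\<in>?X. \<Sum>z\<in>?X. of_real (sqrt (\<alpha> x) * sqrt (\<alpha> z)) * Y z x)"
    by (intro sum.cong refl) (simp only: Y)
  ultimately show ?thesis by simp
qed

lemma bob_output_prob_le_objective:
  assumes \<alpha>: "\<And>a x. x \<in> PiE {1..n} A \<Longrightarrow> 0 \<le> \<alpha> a x"
    and \<beta>: "\<And>b y. y \<in> PiE {1..n} B \<Longrightarrow> 0 \<le> \<beta> b y"
  shows "\<exists>p\<in>alice_polytope n A B. bob_output_prob n A B \<alpha> \<beta> S c \<le> alice_objective n A B \<alpha> \<beta> c p"
proof
  have fin: "finite (PiE {1..n} A)" "finite (PiE {1..n} B)"
    using finA finB by (auto intro!: finite_PiE)
  have "bob_output_prob n A B \<alpha> \<beta> S c \<le> (\<Sum>a\<in>UNIV. \<Sum>y\<in>PiE {1..n} B. \<beta> (a \<noteq> c) y / 2 *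
      fidelity (PiE {1..n} A) (\<lambda>x. branch_reveal (a, x, y)) (\<alpha> a))"
    by (subst bob_output_prob_eq[OF n valid fin], erule \<beta>,
        intro sum_mono mult_left_mono branch_fidelity_bound) (auto simp: \<alpha> \<beta>)
  also have "\<dots> = alice_objective n A B \<alpha> \<beta> c (branch_sigma, branch_reveal)"
    by (simp add: alice_objective_def sum_distrib_left mult.assoc)
  finally show "bob_output_prob n A B \<alpha> \<beta> S c \<le> alice_objective n A B \<alpha> \<beta> c (branch_sigma, branch_reveal)" .
qed (rule branch_point_in_polytope)

end

section \<open>Channels given by isometries\<close>

lemma psd_rank_one:
  assumes "\<And>i. i \<notin> I \<Longrightarrow> u i = 0"
  shows "psd I (rank_one u)"
  unfolding psd_def
proof (intro conjI allI)
  show "rank_one u \<in> operators I" using assms by (auto simp: operators_def rank_one_def)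
  fix v :: "'a \<Rightarrow> complex"
  define z where "z = (\<Sum>i\<in>I. cnj (v i) * u i)"
  have "(\<Sum>i\<in>I. \<Sum>j\<in>I. cnj (v i) * rank_one u i j * v j) = z * cnj z"
    by (simp add: z_def rank_one_def sum_product algebra_simps)
  also have "\<dots> = of_real ((cmod z)\<^sup>2)" by (simp add: complex_norm_square del: of_real_power)
  finally show "(\<Sum>i\<in>I. \<Sum>j\<in>I. cnj (v i) * rank_one u i j * v j) \<in> \<real>\<^sub>\<ge>\<^sub>0"
    by simp
qed

lemma regroup_rank_one: "regroup J g (rank_one u) = rank_one (\<lambda>p. if p \<in> J then u (g p) else 0)"
  by (auto simp: regroup_def rank_one_def fun_eq_iff)

definition conj_channel :: "'i set \<Rightarrow> 'j set \<Rightarrow> ('j \<Rightarrow> 'i \<Rightarrow> complex) \<Rightarrow> 'i op \<Rightarrow> 'j op" where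
  "conj_channel I J V X = (\<lambda>j j'. if j \<in> J \<and> j' \<in> J
     then \<Sum>i\<in>I. \<Sum>i'\<in>I. V j i * X i i' * cnj (V j' i') else 0)"

lemma sum_sandwich:
  fixes X :: "'i \<Rightarrow> 'i \<Rightarrow> complex"
  shows "(\<Sum>j\<in>J. \<Sum>j'\<in>J. a j * (\<Sum>i\<in>I. \<Sum>i'\<in>I. V j i * X i i' * W j' i') * b j')
    = (\<Sum>i\<in>I. \<Sum>i'\<in>I. (\<Sum>j\<in>J. a j * V j i) * X i i' * (\<Sum>j'\<in>J. W j' i' * b j'))"
proof -
  have "(\<Sum>j\<in>J. \<Sum>j'\<in>J. a j * (\<Sum>i\<in>I. \<Sum>i'\<in>I. V j i * X i i' * W j' i') * b j')
    = (\<Sum>j\<in>J. \<Sum>j'\<in>J. \<Sum>i\<in>I. \<Sum>i'\<in>I. (a j * V j i) * X i i' * (W j' i' * b j'))"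
    by (simp only: sum_distrib_left sum_distrib_right mult.assoc)
  also have "\<dots> = (\<Sum>j\<in>J. \<Sum>i\<in>I. \<Sum>i'\<in>I. \<Sum>j'\<in>J. (a j * V j i) * X i i' * (W j' i' * b j'))"
    by (rule sum.cong[OF refl], (rule trans[OF sum.swap], rule sum.cong[OF refl])+, rule refl)
  also have "\<dots> = (\<Sum>i\<in>I. \<Sum>i'\<in>I. \<Sum>j\<in>J. \<Sum>j'\<in>J. (a j * V j i) * X i i' * (W j' i' * b j'))"
    by (rule trans[OF sum.swap], rule sum.cong[OF refl], rule sum.swap)
  also have "\<dots> = (\<Sum>i\<in>I. \<Sum>i'\<in>I. (\<Sum>j\<in>J. a j * V j i) * X i i' * (\<Sum>j'\<in>J. W j' i' * b j'))"
    by (simp only: sum_distrib_right) (simp only: sum_distrib_left)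
  finally show ?thesis .
qed

text \<open>
  The quadratic form of \<open>V X V\<^sup>*\<close> at \<open>v\<close> is the form of \<open>X\<close> at \<open>V\<^sup>* v\<close>, which gives complete positivity; the trace
  is preserved because the columns of \<open>V\<close> are orthonormal.
\<close>
lemma conj_channel_quantum:
  fixes V :: "'j \<Rightarrow> 'i \<Rightarrow> complex"
  assumes fin: "finite I" "finite J"
    and iso: "\<And>i i'. i \<in> I \<Longrightarrow> i' \<in> I \<Longrightarrow> (\<Sum>j\<in>J. cnj (V j i') * V j i) = of_bool (i = i')"
  shows "quantum_channel I J (conj_channel I J V)"
  unfolding quantum_channel_def
proof (intro conjI ballI allI impI)
  show "linear_super I J (conj_channel I J V)"
    by (auto simp: linear_super_def conj_channel_def operators_def fun_eq_iff sum.distrib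
        sum_distrib_left algebra_simps)
next
  fix X :: "'i op"
  have "op_trace J (conj_channel I J V X) = (\<Sum>j\<in>J. \<Sum>i\<in>I. \<Sum>i'\<in>I. X i i' * (cnj (V j i') * V j i))"
    unfolding op_trace_def conj_channel_def by (intro sum.cong refl) (simp add: algebra_simps)
  also have "\<dots> = (\<Sum>i\<in>I. \<Sum>i'\<in>I. \<Sum>j\<in>J. X i i' * (cnj (V j i') * V j i))"
    by (rule trans[OF sum.swap], rule sum.cong[OF refl], rule sum.swap)
  also have "\<dots> = (\<Sum>i\<in>I. \<Sum>i'\<in>I. if i' = i then X i i' else 0)"
    by (intro sum.cong refl) (auto simp: iso simp flip: sum_distrib_left)
  also have "\<dots> = op_trace I X" using fin by (simp add: op_trace_def)
  finally show "op_trace J (conj_channel I J V X) = op_trace I X" .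
next
  fix m :: nat and X :: "('i \<times> nat) op"
  assume X: "psd (I \<times> {..<m}) X"
  have eq: "super_tensor_id (conj_channel I J V) X (j, k) (j', l) =
      (if j \<in> J \<and> j' \<in> J then \<Sum>i\<in>I. \<Sum>i'\<in>I. V j i * X (i, k) (i', l) * cnj (V j' i') else 0)" for j k j' l
    by (simp add: super_tensor_id_apply conj_channel_def)
  show "psd (J \<times> {..<m}) (super_tensor_id (conj_channel I J V) X)"
    unfolding psd_def
  proof (intro conjI allI)
    have "super_tensor_id (conj_channel I J V) X (j, k) (j', l) = 0"
      if "(j, k) \<notin> J \<times> {..<m} \<or> (j', l) \<notin> J \<times> {..<m}" for j k j' l
    proof -
      have "X (i, k) (i', l) = 0" if "j \<in> J" "j' \<in> J" for i i'
        by (rule operators_outside[OF psd_operators[OF X]])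
          (use that \<open>(j, k) \<notin> J \<times> {..<m} \<or> (j', l) \<notin> J \<times> {..<m}\<close> in auto)
      then show ?thesis by (simp add: eq)
    qed
    then show "super_tensor_id (conj_channel I J V) X \<in> operators (J \<times> {..<m})"
      by (auto simp: operators_def)
    fix v :: "'j \<times> nat \<Rightarrow> complex"
    define u where "u = (\<lambda>(i, l). \<Sum>j\<in>J. cnj (V j i) * v (j, l))"
    have "(\<Sum>p\<in>J \<times> {..<m}. \<Sum>q\<in>J \<times> {..<m}. cnj (v p) * super_tensor_id (conj_channel I J V) X p q * v q)
      = (\<Sum>j\<in>J. \<Sum>k<m. \<Sum>j'\<in>J. \<Sum>l<m. cnj (v (j, k)) *
          (\<Sum>i\<in>I. \<Sum>i'\<in>I. V j i * X (i, k) (i', l) * cnj (V j' i')) * v (j', l))"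
      by (simp add: sum.cartesian_product' eq cong: sum.cong)
    also have "\<dots> = (\<Sum>k<m. \<Sum>j\<in>J. \<Sum>l<m. \<Sum>j'\<in>J. cnj (v (j, k)) *
          (\<Sum>i\<in>I. \<Sum>i'\<in>I. V j i * X (i, k) (i', l) * cnj (V j' i')) * v (j', l))"
      by (rule trans[OF sum.swap], intro sum.cong refl, rule sum.swap)
    also have "\<dots> = (\<Sum>k<m. \<Sum>l<m. \<Sum>j\<in>J. \<Sum>j'\<in>J. cnj (v (j, k)) *
          (\<Sum>i\<in>I. \<Sum>i'\<in>I. V j i * X (i, k) (i', l) * cnj (V j' i')) * v (j', l))"
      by (intro sum.cong refl, rule sum.swap)
    also have "\<dots> = (\<Sum>k<m. \<Sum>l<m. \<Sum>i\<in>I. \<Sum>i'\<in>I. cnj (u (i, k)) * X (i, k) (i', l) * u (i', l))"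
      unfolding sum_sandwich u_def by (simp add: mult.commute)
    also have "\<dots> = (\<Sum>k<m. \<Sum>i\<in>I. \<Sum>l<m. \<Sum>i'\<in>I. cnj (u (i, k)) * X (i, k) (i', l) * u (i', l))"
      by (intro sum.cong refl, rule sum.swap)
    also have "\<dots> = (\<Sum>i\<in>I. \<Sum>k<m. \<Sum>i'\<in>I. \<Sum>l<m. cnj (u (i, k)) * X (i, k) (i', l) * u (i', l))"
      by (rule trans[OF sum.swap], intro sum.cong refl, rule sum.swap)
    also have "\<dots> = (\<Sum>p\<in>I \<times> {..<m}. \<Sum>q\<in>I \<times> {..<m}. cnj (u p) * X p q * u q)"
      by (simp add: sum.cartesian_product')
    also have "\<dots> \<in> \<real>\<^sub>\<ge>\<^sub>0" by (rule psd_quadratic_form[OF X])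
    finally show "(\<Sum>p\<in>J \<times> {..<m}. \<Sum>q\<in>J \<times> {..<m}.
        cnj (v p) * super_tensor_id (conj_channel I J V) X p q * v q) \<in> \<real>\<^sub>\<ge>\<^sub>0" .
  qed
qed

lemma conj_channel_rank_one:
  "super_tensor_id (conj_channel I J V) (rank_one u) =
    rank_one (\<lambda>(j, k). if j \<in> J then \<Sum>i\<in>I. V j i * u (i, k) else 0)"
  by (auto simp: super_tensor_id_def conj_channel_def rank_one_def fun_eq_iff sum_product algebra_simps)

text \<open>
  Conjugation with the map that sends \<open>e\<^sub>i\<close> to the superposition over \<open>a\<close> of \<open>e\<^sub>a \<otimes> e\<^bsub>f a i\<^esub>\<close> with amplitudes
  \<open>sqrt (r a i)\<close>: a coherent sample \<open>a\<close> from the distribution \<open>r\<close> given \<open>i\<close>, with a label \<open>f a i\<close> kept in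
  the workspace.
\<close>
definition branching_channel ::
  "'i set \<Rightarrow> 'o set \<Rightarrow> nat \<Rightarrow> ('o \<Rightarrow> 'i \<Rightarrow> nat) \<Rightarrow> ('o \<Rightarrow> 'i \<Rightarrow> real) \<Rightarrow> 'i op \<Rightarrow> ('o \<times> nat) op"
where
  "branching_channel I M d f r = conj_channel I (M \<times> {..<d})
     (\<lambda>(a, w) i. if w = f a i then of_real (sqrt (r a i)) else 0)"

text \<open>
  Two columns can only overlap in a basis element \<open>(a, w)\<close> that has positive probability in both, and the
  hypothesis \<open>sep\<close> says that such an element determines the column.
\<close>
lemma branching_channel_quantum:
  assumes fin: "finite I" "finite M"
    and f: "\<And>a i. a \<in> M \<Longrightarrow> i \<in> I \<Longrightarrow> f a i < d"
    and r: "\<And>a i. a \<in> M \<Longrightarrow> i \<in> I \<Longrightarrow> 0 \<le> r a i"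
    and sum_r: "\<And>i. i \<in> I \<Longrightarrow> (\<Sum>a\<in>M. r a i) = 1"
    and sep: "\<And>a i i'. a \<in> M \<Longrightarrow> i \<in> I \<Longrightarrow> i' \<in> I \<Longrightarrow> f a i = f a i' \<Longrightarrow> r a i \<noteq> 0 \<Longrightarrow> r a i' \<noteq> 0 \<Longrightarrow> i = i'"
  shows "quantum_channel I (M \<times> {..<d}) (branching_channel I M d f r)"
  unfolding branching_channel_def
proof (rule conj_channel_quantum)
  fix i i' assume i: "i \<in> I" "i' \<in> I"
  let ?V = "\<lambda>(a, w) i. if w = f a i then complex_of_real (sqrt (r a i)) else 0"
  have "(\<Sum>p\<in>M \<times> {..<d}. cnj (?V p i') * ?V p i) = (\<Sum>a\<in>M. \<Sum>w<d. cnj (?V (a, w) i') * ?V (a, w) i)"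
    by (simp only: sum.cartesian_product')
  also have "\<dots> = (\<Sum>a\<in>M. if i = i' then of_real (r a i) else 0)"
  proof (rule sum.cong[OF refl])
    fix a assume a: "a \<in> M"
    have "(\<Sum>w<d. cnj (?V (a, w) i') * ?V (a, w) i) =
        (\<Sum>w<d. if w = f a i then (if f a i = f a i' then of_real (sqrt (r a i) * sqrt (r a i')) else 0) else 0)"
      by (intro sum.cong refl) auto
    also have "\<dots> = (if f a i = f a i' then of_real (sqrt (r a i) * sqrt (r a i')) else 0)"
      using f[OF a i(1)] by simp
    also have "\<dots> = (if i = i' then of_real (r a i) else 0)"
      using r[OF a i(1)] sep[OF a i] by (auto simp flip: of_real_mult)
    finally show "(\<Sum>w<d. cnj (?V (a, w) i') * ?V (a, w) i) = (if i = i' then of_real (r a i) else 0)" .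
  qed
  also have "\<dots> = of_bool (i = i')"
    using sum_r[OF i(1)] by (auto simp flip: of_real_sum)
  finally show "(\<Sum>p\<in>M \<times> {..<d}. cnj (?V p i') * ?V p i) = of_bool (i = i')" .
qed (use fin in auto)

text \<open>
  The form in which the channel is applied to the states of the strategy below: for each record \<open>x\<close> of Bob,
  Alice's register is in a single basis state \<open>i0 x\<close>.
\<close>
lemma branching_channel_rank_one:
  assumes fin: "finite I" and i0: "\<And>x. x \<in> K \<Longrightarrow> i0 x \<in> I"
    and u: "\<And>i x. i \<in> I \<Longrightarrow> u (i, x) = (if x \<in> K \<and> i = i0 x then c x else 0)"
  shows "super_tensor_id (branching_channel I M d f r) (rank_one u) =
    rank_one (\<lambda>((a, w), x). if x \<in> K \<and> a \<in> M \<and> w < d \<and> w = f a (i0 x)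
      then of_real (sqrt (r a (i0 x))) * c x else 0)"
proof -
  have amp: "(\<Sum>i\<in>I. (if w = f a i then complex_of_real (sqrt (r a i)) else 0) * u (i, x))
      = (if x \<in> K \<and> w = f a (i0 x) then of_real (sqrt (r a (i0 x))) * c x else 0)" for a w x
  proof (cases "x \<in> K")
    case True
    have "(\<Sum>i\<in>I. (if w = f a i then complex_of_real (sqrt (r a i)) else 0) * u (i, x))
      = (\<Sum>i\<in>I. if i = i0 x then (if w = f a (i0 x) then of_real (sqrt (r a (i0 x))) else 0) * c x else 0)"
      by (intro sum.cong refl) (simp add: u True)
    then show ?thesis using fin i0[OF True] True by simp
  qed (simp add: u)
  show ?thesis
    unfolding branching_channel_def conj_channel_rank_one
    by (rule arg_cong[where f = rank_one]) (auto simp: fun_eq_iff amp)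
qed

section \<open>The strategy attached to a point of the polytope\<close>

text \<open>
  Workspaces have bases \<open>{..<d}\<close>, so the transcripts that Alice remembers are numbered. Since the numbering
  is onto, every basis element of the workspace stands for a transcript, and the channels have to be
  specified for transcripts only.
\<close>
definition enumerate_set :: "'x set \<Rightarrow> 'x \<Rightarrow> nat" where
  "enumerate_set W = (SOME h. bij_betw h W {..<card W})"

lemma bij_betw_enumerate_set:
  assumes "finite W"
  shows "bij_betw (enumerate_set W) W {..<card W}"
proof -
  obtain h where "bij_betw h W {..<card W}"
    using ex_bij_betw_finite_nat[OF assms] by (auto simp: atLeast0LessThan)
  then show ?thesis
    unfolding enumerate_set_def by (rule someI[of "\<lambda>h. bij_betw h W {..<card W}"])
qed

lemma enumerate_set_less: "finite W \<Longrightarrow> p \<in> W \<Longrightarrow> enumerate_set W p < card W"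
  using bij_betw_enumerate_set[of W] by (auto simp: bij_betw_def)

definition label_of :: "'x set \<Rightarrow> nat \<Rightarrow> 'x" where
  "label_of W = inv_into W (enumerate_set W)"

lemma label_of_mem: "finite W \<Longrightarrow> w < card W \<Longrightarrow> label_of W w \<in> W"
  using bij_betw_enumerate_set[of W] unfolding label_of_def
  by (metis bij_betw_imp_surj_on inv_into_into lessThan_iff)

lemma label_of_enumerate: "finite W \<Longrightarrow> p \<in> W \<Longrightarrow> label_of W (enumerate_set W p) = p"
  using bij_betw_enumerate_set[of W] unfolding label_of_def by (simp add: bij_betw_inv_into_left)

lemma enumerate_label_of: "finite W \<Longrightarrow> w < card W \<Longrightarrow> enumerate_set W (label_of W w) = w"
  using bij_betw_enumerate_set[of W] unfolding label_of_def by (simp add: bij_betw_inv_into_right)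

lemma enumerate_set_eq_iff:
  "finite W \<Longrightarrow> p \<in> W \<Longrightarrow> q \<in> W \<Longrightarrow> enumerate_set W p = enumerate_set W q \<longleftrightarrow> p = q"
  by (metis label_of_enumerate)

lemma label_of_eq_iff:
  "finite W \<Longrightarrow> w < card W \<Longrightarrow> w' < card W \<Longrightarrow> label_of W w = label_of W w' \<longleftrightarrow> w = w'"
  by (metis enumerate_label_of)

text \<open>
  The string \<open>x0\<close> provides a default next letter after transcripts of probability zero.
\<close>
context
  fixes n :: nat and A :: "nat \<Rightarrow> 'a set" and B :: "nat \<Rightarrow> 'b set"
    and \<sigma> :: "nat \<Rightarrow> (nat \<Rightarrow> 'a) \<times> (nat \<Rightarrow> 'b) \<Rightarrow> real"
    and s :: "bool \<times> (nat \<Rightarrow> 'a) \<times> (nat \<Rightarrow> 'b) \<Rightarrow> real" and x0 :: "nat \<Rightarrow> 'a"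
  assumes n: "1 \<le> n" and finA: "\<And>i. i \<in> {1..n} \<Longrightarrow> finite (A i)"
    and finB: "\<And>i. i \<in> {1..n} \<Longrightarrow> finite (B i)"
    and x0: "x0 \<in> PiE {1..n} A"
    and point: "(\<sigma>, s) \<in> alice_polytope n A B"
begin

text \<open>
  What Alice remembers when she sends message \<open>i\<close>: the letters \<open>1, \<dots>, i\<close> of \<open>x\<close> and the replies \<open>1, \<dots>, i - 1\<close>.
\<close>
definition transcripts :: "nat \<Rightarrow> ((nat \<Rightarrow> 'a) \<times> (nat \<Rightarrow> 'b)) set" where
  "transcripts i = PiE {1..<Suc i} A \<times> PiE {1..<i} B"

text \<open>
  From the transcript of message \<open>i\<close> and the reply \<open>v\<close>, the letter \<open>a\<close> leads to a longer transcript with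
  conditional probability \<open>\<sigma> (i + 1) / \<sigma> i\<close>.
\<close>
definition next_label :: "nat \<Rightarrow> 'a \<Rightarrow> nat \<times> 'b \<Rightarrow> nat" where
  "next_label i a = (\<lambda>(w, v). case label_of (transcripts i) w of (x, y) \<Rightarrow>
     enumerate_set (transcripts (Suc i)) (x(Suc i := a), y(i := v)))"

definition next_prob :: "nat \<Rightarrow> 'a \<Rightarrow> nat \<times> 'b \<Rightarrow> real" where
  "next_prob i a = (\<lambda>(w, v). case label_of (transcripts i) w of (x, y) \<Rightarrow>
     if \<sigma> i (x, y) = 0 then of_bool (a = x0 (Suc i)) else \<sigma> (Suc i) (x(Suc i := a), y(i := v)) / \<sigma> i (x, y))"

text \<open>
  In the last message Alice hands over her copy of \<open>x\<close> as \<open>A'\<close>, so that the workspace has to retain only \<open>y\<close>.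
  Keeping \<open>x\<close> as well would destroy the superposition over \<open>x\<close> on which Bob's test depends.
\<close>
definition reveal_label :: "bool \<times> (nat \<Rightarrow> 'a) \<Rightarrow> nat \<times> 'b \<Rightarrow> nat" where
  "reveal_label = (\<lambda>_ (w, v). case label_of (transcripts n) w of (x, y) \<Rightarrow>
     enumerate_set (PiE {1..n} B) (y(n := v)))"

definition reveal_prob :: "bool \<times> (nat \<Rightarrow> 'a) \<Rightarrow> nat \<times> 'b \<Rightarrow> real" where
  "reveal_prob = (\<lambda>(a, x') (w, v). case label_of (transcripts n) w of (x, y) \<Rightarrow>
     if x' \<noteq> x then 0 else if \<sigma> n (x, y) = 0 then of_bool a else s (a, x, y(n := v)) / \<sigma> n (x, y))"

definition point_ws_dim :: "nat \<Rightarrow> nat" where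
  "point_ws_dim i = (if i \<le> n then card (transcripts i) else card (PiE {1..n} B))"

text \<open>
  The amplitudes of the state after \<open>k\<close> rounds in the branch of \<open>y\<close>: Alice's transcript is determined by Bob's
  record \<open>x\<close>, her next letter \<open>a\<close> and the replies.
\<close>
definition stage_amp :: "(nat \<Rightarrow> 'b) \<Rightarrow> nat \<Rightarrow> ('a \<times> nat) \<times> (nat \<Rightarrow> 'a) \<Rightarrow> complex" where
  "stage_amp y k = (\<lambda>((a, w), x). let p = (x(Suc k := a), restrict y {1..<Suc k}) in
     if x \<in> PiE {1..<Suc k} A \<and> a \<in> A (Suc k) \<and> w = enumerate_set (transcripts (Suc k)) p
     then of_real (sqrt (\<sigma> (Suc k) p)) else 0)"

definition point_strategy :: "('a, 'b) alice_strategy" where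
  "point_strategy = \<lparr>
     ws_dim = point_ws_dim,
     init_state = rank_one (\<lambda>p. stage_amp (\<lambda>_. undefined) 0 (p, \<lambda>_. undefined)),
     round_op = (\<lambda>i. branching_channel ({..<point_ws_dim i} \<times> B i) (A (Suc i)) (point_ws_dim (Suc i))
       (next_label i) (next_prob i)),
     reveal_op = branching_channel ({..<point_ws_dim n} \<times> B n) (UNIV \<times> PiE {1..n} A)
       (point_ws_dim (Suc n)) reveal_label reveal_prob,
     n_out = 1,
     final_meas = (\<lambda>_ p q. of_bool (p = q \<and> p \<in> {..<point_ws_dim (Suc n)} \<times> UNIV \<times> PiE {1..n} B))\<rparr>"

lemmas poly = alice_polytope_memD[OF point]

lemma finite_transcripts: "i \<le> n \<Longrightarrow> finite (transcripts i)"
  unfolding transcripts_def using finA finB by (intro finite_cartesian_product finite_PiE) auto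

lemma transcripts_Suc:
  assumes "(x, y) \<in> transcripts i" "1 \<le> i" "a \<in> A (Suc i)" "v \<in> B i"
  shows "(x(Suc i := a), y(i := v)) \<in> transcripts (Suc i)"
  using assms PiE_upd_mem[of "Suc i" x A a] PiE_upd_mem[of i y B v] by (simp add: transcripts_def)

lemma sigma_nonneg: "i \<in> {1..n} \<Longrightarrow> p \<in> transcripts i \<Longrightarrow> 0 \<le> \<sigma> i p"
  using poly(1)[of i "fst p" "snd p"]
  by (cases p) (simp add: transcripts_def atLeastLessThanSuc_atLeastAtMost)

lemma sigma_Suc_sum:
  assumes "i \<in> {1..<n}" "(x, y) \<in> transcripts i" "v \<in> B i"
  shows "(\<Sum>a\<in>A (Suc i). \<sigma> (Suc i) (x(Suc i := a), y(i := v))) = \<sigma> i (x, y)"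
proof -
  have "x \<in> PiE {1..<Suc i} A" "y(i := v) \<in> PiE {1..<Suc i} B" "(y(i := v))(i := undefined) = y"
    using assms PiE_upd_mem[of i y B v] PiE_upd_undefined[of y i B v] by (simp_all add: transcripts_def)
  with poly(4)[of "Suc i" x "y(i := v)"] assms(1) show ?thesis
    by (simp del: fun_upd_apply fun_upd_upd)
qed

lemma reveal_sum:
  assumes "(x, y) \<in> transcripts n" "v \<in> B n"
  shows "(\<Sum>a\<in>UNIV. s (a, x, y(n := v))) = \<sigma> n (x, y)"
proof -
  have "x \<in> PiE {1..n} A" "y(n := v) \<in> PiE {1..n} B" "(y(n := v))(n := undefined) = y"
    using assms n PiE_add_last[of n y B v] PiE_upd_undefined[of y n B v]
    by (simp_all add: transcripts_def atLeastLessThanSuc_atLeastAtMost)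
  with poly(5)[of x "y(n := v)"] show ?thesis by simp
qed

lemma reveal_nonneg:
  assumes "(x, y) \<in> transcripts n" "v \<in> B n"
  shows "0 \<le> s (a, x, y(n := v))"
  using assms n PiE_add_last[of n y B v] poly(2)[of x "y(n := v)" a]
  by (simp add: transcripts_def atLeastLessThanSuc_atLeastAtMost)

text \<open>
  The longer transcript determines the shorter one and the reply, so the labels separate the inputs.
\<close>
lemma round_channel:
  assumes i: "i \<in> {1..<n}"
  shows "quantum_channel ({..<point_ws_dim i} \<times> B i) (A (Suc i) \<times> {..<point_ws_dim (Suc i)})
    (branching_channel ({..<point_ws_dim i} \<times> B i) (A (Suc i)) (point_ws_dim (Suc i)) (next_label i) (next_prob i))"
proof (rule branching_channel_quantum)
  have fin: "finite (transcripts i)" "finite (transcripts (Suc i))"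
    using i by (auto intro!: finite_transcripts)
  have dims: "point_ws_dim i = card (transcripts i)" "point_ws_dim (Suc i) = card (transcripts (Suc i))"
    using i by (auto simp: point_ws_dim_def)
  show "finite ({..<point_ws_dim i} \<times> B i)" "finite (A (Suc i))" using finA finB i by auto
  fix p assume "p \<in> {..<point_ws_dim i} \<times> B i"
  then obtain w v where p: "p = (w, v)" and w: "w < card (transcripts i)" and v: "v \<in> B i"
    by (auto simp: dims)
  obtain x y where xy: "label_of (transcripts i) w = (x, y)" by (cases "label_of (transcripts i) w")
  have mem: "(x, y) \<in> transcripts i" using label_of_mem[OF fin(1) w] by (simp add: xy)
  have mem': "(x(Suc i := a), y(i := v)) \<in> transcripts (Suc i)" if "a \<in> A (Suc i)" for a
    using transcripts_Suc[OF mem _ that v] i by simp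
  have nn: "0 \<le> \<sigma> (Suc i) (x(Suc i := a), y(i := v))" if "a \<in> A (Suc i)" for a
    by (rule sigma_nonneg) (use mem'[OF that] i in auto)
  have nn': "0 \<le> \<sigma> i (x, y)" by (rule sigma_nonneg) (use mem i in auto)
  show "next_label i a p < point_ws_dim (Suc i)" if "a \<in> A (Suc i)" for a
    using enumerate_set_less[OF fin(2) mem'[OF that]] by (simp add: next_label_def p xy dims)
  show "0 \<le> next_prob i a p" if "a \<in> A (Suc i)" for a
    using nn[OF that] nn' by (simp add: next_prob_def p xy)
  show "(\<Sum>a\<in>A (Suc i). next_prob i a p) = 1"
  proof (cases "\<sigma> i (x, y) = 0")
    case True
    have "x0 (Suc i) \<in> A (Suc i)" by (rule PiE_mem[OF x0]) (use i in auto)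
    then show ?thesis using True finA[of "Suc i"] i by (simp add: next_prob_def p xy of_bool_def)
  next
    case False
    then show ?thesis
      using sigma_Suc_sum[OF i mem v] by (simp add: next_prob_def p xy flip: sum_divide_distrib)
  qed
  fix a p' assume a: "a \<in> A (Suc i)" and "p' \<in> {..<point_ws_dim i} \<times> B i"
    and eq: "next_label i a p = next_label i a p'"
  then obtain w' v' where p': "p' = (w', v')" and w': "w' < card (transcripts i)" and v': "v' \<in> B i"
    by (auto simp: dims)
  obtain x' y' where xy': "label_of (transcripts i) w' = (x', y')" by (cases "label_of (transcripts i) w'")
  have mem2: "(x', y') \<in> transcripts i" using label_of_mem[OF fin(1) w'] by (simp add: xy')
  have "(x'(Suc i := a), y'(i := v')) \<in> transcripts (Suc i)"
    using transcripts_Suc[OF mem2 _ a v'] i by simp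
  from enumerate_set_eq_iff[OF fin(2) mem'[OF a] this] eq
  have "x(Suc i := a) = x'(Suc i := a)" "y(i := v) = y'(i := v')"
    by (simp_all add: next_label_def p p' xy xy')
  then have "x = x'" "y = y'" "v = v'"
    using PiE_upd_eq_iff[of x "Suc i" A x' a a] PiE_upd_eq_iff[of y i B y' v v'] mem mem2
    by (auto simp: transcripts_def)
  then show "p = p'"
    using label_of_eq_iff[OF fin(1) w w'] xy xy' by (simp add: p p')
qed

text \<open>
  The workspace label gives back \<open>y\<close> and the last reply, and the revealed string \<open>A'\<close> gives back \<open>x\<close>, because
  other strings have probability zero.
\<close>
lemma reveal_channel:
  "quantum_channel ({..<point_ws_dim n} \<times> B n) ((UNIV \<times> PiE {1..n} A) \<times> {..<point_ws_dim (Suc n)})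
    (branching_channel ({..<point_ws_dim n} \<times> B n) (UNIV \<times> PiE {1..n} A) (point_ws_dim (Suc n)) reveal_label reveal_prob)"
proof (rule branching_channel_quantum)
  have fin: "finite (transcripts n)" "finite (PiE {1..n} A)" "finite (PiE {1..n} B)"
    using finA finB by (auto intro!: finite_transcripts finite_PiE)
  have dims: "point_ws_dim n = card (transcripts n)" "point_ws_dim (Suc n) = card (PiE {1..n} B)"
    by (auto simp: point_ws_dim_def)
  show "finite ({..<point_ws_dim n} \<times> B n)" using finB n by auto
  show "finite ((UNIV :: bool set) \<times> PiE {1..n} A)" using fin by simp
  fix p assume "p \<in> {..<point_ws_dim n} \<times> B n"
  then obtain w v where p: "p = (w, v)" and w: "w < card (transcripts n)" and v: "v \<in> B n"
    by (auto simp: dims)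
  obtain x y where xy: "label_of (transcripts n) w = (x, y)" by (cases "label_of (transcripts n) w")
  have mem: "(x, y) \<in> transcripts n" using label_of_mem[OF fin(1) w] by (simp add: xy)
  have x: "x \<in> PiE {1..n} A" using mem by (simp add: transcripts_def atLeastLessThanSuc_atLeastAtMost)
  have y: "y(n := v) \<in> PiE {1..n} B" using mem PiE_add_last[OF n, of y B v] v by (simp add: transcripts_def)
  have nn': "0 \<le> \<sigma> n (x, y)" by (rule sigma_nonneg) (use mem n in auto)
  show "reveal_label o1 p < point_ws_dim (Suc n)" for o1
    using enumerate_set_less[OF fin(3) y] by (simp add: reveal_label_def p xy dims)
  show "0 \<le> reveal_prob o1 p" for o1
    using reveal_nonneg[OF mem v] nn' by (cases o1) (simp add: reveal_prob_def p xy)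
  show "(\<Sum>o1\<in>UNIV \<times> PiE {1..n} A. reveal_prob o1 p) = 1"
  proof -
    have "(\<Sum>o1\<in>UNIV \<times> PiE {1..n} A. reveal_prob o1 p)
      = (\<Sum>a\<in>UNIV. \<Sum>x'\<in>PiE {1..n} A. if x' = x then
          (if \<sigma> n (x, y) = 0 then of_bool a else s (a, x, y(n := v)) / \<sigma> n (x, y)) else 0)"
      unfolding sum.cartesian_product' by (intro sum.cong refl) (simp add: reveal_prob_def p xy)
    also have "\<dots> = (\<Sum>a\<in>UNIV. if \<sigma> n (x, y) = 0 then of_bool a else s (a, x, y(n := v)) / \<sigma> n (x, y))"
      using fin x by simp
    also have "\<dots> = 1"
    proof (cases "\<sigma> n (x, y) = 0")
      case False
      then show ?thesis using reveal_sum[OF mem v] by (simp flip: sum_divide_distrib)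
    qed (simp add: UNIV_bool)
    finally show ?thesis .
  qed
  fix o1 p' assume "p' \<in> {..<point_ws_dim n} \<times> B n"
    and eq: "reveal_label o1 p = reveal_label o1 p'"
    and nz: "reveal_prob o1 p \<noteq> 0" "reveal_prob o1 p' \<noteq> 0"
  then obtain w' v' where p': "p' = (w', v')" and w': "w' < card (transcripts n)" and v': "v' \<in> B n"
    by (auto simp: dims)
  obtain x' y' where xy': "label_of (transcripts n) w' = (x', y')" by (cases "label_of (transcripts n) w'")
  have mem2: "(x', y') \<in> transcripts n" using label_of_mem[OF fin(1) w'] by (simp add: xy')
  have y': "y'(n := v') \<in> PiE {1..n} B"
    using mem2 PiE_add_last[OF n, of y' B v'] v' by (simp add: transcripts_def)
  from enumerate_set_eq_iff[OF fin(3) y y'] eq have "y(n := v) = y'(n := v')"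
    by (simp add: reveal_label_def p p' xy xy')
  then have "y = y'" "v = v'"
    using PiE_upd_eq_iff[of y n B y' v v'] mem mem2 by (auto simp: transcripts_def)
  moreover have "x = x'"
    using nz by (cases o1) (auto simp: reveal_prob_def p p' xy xy' split: if_splits)
  ultimately show "p = p'"
    using label_of_eq_iff[OF fin(1) w w'] xy xy' by (simp add: p p')
qed

lemma transcript_prefix:
  assumes "x \<in> PiE {1..<Suc i} A" "y \<in> PiE {1..n} B" "i \<le> n"
  shows "(x, restrict y {1..<i}) \<in> transcripts i"
  using assms by (auto simp: transcripts_def PiE_def Pi_def)

lemma stage_receive:
  assumes i: "1 \<le> i" "i \<le> n" and y: "y \<in> PiE {1..n} B"
  shows "receive A S i (y i) (rank_one (stage_amp y (i - 1))) =
    rank_one (\<lambda>((w, v), x). if w < ws_dim S i \<and> v = y i \<and> x \<in> PiE {1..<Suc i} A \<and>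
        w = enumerate_set (transcripts i) (x, restrict y {1..<i})
      then of_real (sqrt (\<sigma> i (x, restrict y {1..<i}))) else 0)"
proof -
  have "stage_amp y (i - 1) ((x i, w), x(i := undefined)) =
      (if w = enumerate_set (transcripts i) (x, restrict y {1..<i})
       then of_real (sqrt (\<sigma> i (x, restrict y {1..<i}))) else 0)"
    if x: "x \<in> PiE {1..<Suc i} A" for x w
  proof -
    have "x(i := undefined) \<in> PiE {1..<i} A" "x i \<in> A i"
      using x i PiE_remove_last[of x i A] by (auto simp: atLeastLessThanSuc_atLeastAtMost)
    moreover have "Suc (i - 1) = i" using i by simp
    ultimately show ?thesis unfolding stage_amp_def by simp
  qed
  then show ?thesis
    unfolding receive_def regroup_rank_one
    by (intro arg_cong[where f = rank_one]) (auto simp: fun_eq_iff atLeastLessThanSuc_atLeastAtMost simp del: fun_upd_apply)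
qed

lemma sqrt_share: "0 \<le> \<tau> \<Longrightarrow> 0 \<le> \<theta> \<Longrightarrow> \<theta> \<le> \<tau> \<Longrightarrow>
    sqrt (if \<tau> = 0 then t else \<theta> / \<tau>) * sqrt \<tau> = sqrt \<theta>" for \<tau> \<theta> t :: real
  by (auto simp flip: real_sqrt_mult)

text \<open>
  The amplitude for a transcript is \<open>sqrt (\<sigma> i)\<close>; the channel multiplies it by the square root of
  \<open>\<sigma> (i + 1) / \<sigma> i\<close>. If \<open>\<sigma> i\<close> vanishes, then so does \<open>\<sigma> (i + 1)\<close>, and the default letter has amplitude zero.
\<close>
lemma point_strategy_branch_state:
  assumes "k < n" and y: "y \<in> PiE {1..n} B"
  shows "branch_state A point_strategy y k = rank_one (stage_amp y k)"
  using assms(1)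
proof (induction k)
  case 0
  have "stage_amp y 0 (p, x) = stage_amp (\<lambda>_. undefined) 0 (p, \<lambda>_. undefined) * basis_vec (\<lambda>_. undefined) x"
    for p x
    by (cases p; cases "x = (\<lambda>_. undefined)")
      (simp_all add: stage_amp_def Let_def restrict_def basis_vec_def)
  then have "rank_one (stage_amp y 0) (p, x) (q, z) = branch_state A point_strategy y 0 (p, x) (q, z)" for p x q z
    by (simp add: rank_one_def op_tensor_def point_strategy_def)
  then show ?case by (auto simp: fun_eq_iff)
next
  case (Suc k)
  define i where "i = Suc k"
  have i: "i \<in> {1..<n}" "i - 1 = k" using Suc.prems by (auto simp: i_def)
  let ?i0 = "\<lambda>x. (enumerate_set (transcripts i) (x, restrict y {1..<i}), y i)"
  let ?c = "\<lambda>x. complex_of_real (sqrt (\<sigma> i (x, restrict y {1..<i})))"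
  let ?K = "PiE {1..<Suc i} A"
  have fin: "finite (transcripts i)" "finite (transcripts (Suc i))"
    using i by (auto intro!: finite_transcripts)
  have dims: "point_ws_dim i = card (transcripts i)" "point_ws_dim (Suc i) = card (transcripts (Suc i))"
    using i by (auto simp: point_ws_dim_def)
  have yi: "y i \<in> B i" by (rule PiE_mem[OF y]) (use i in auto)
  have mem: "(x, restrict y {1..<i}) \<in> transcripts i" if "x \<in> ?K" for x
    by (rule transcript_prefix[OF that y]) (use i in auto)
  have "branch_state A point_strategy y (Suc k) = super_tensor_id
      (branching_channel ({..<point_ws_dim i} \<times> B i) (A (Suc i)) (point_ws_dim (Suc i)) (next_label i) (next_prob i))
      (receive A point_strategy i (y i) (rank_one (stage_amp y (i - 1))))"
    using Suc by (simp add: i_def point_strategy_def)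
  also have "receive A point_strategy i (y i) (rank_one (stage_amp y (i - 1))) =
     rank_one (\<lambda>((w, v), x). if w < ws_dim point_strategy i \<and> v = y i \<and> x \<in> ?K \<and>
        w = enumerate_set (transcripts i) (x, restrict y {1..<i}) then ?c x else 0)"
    by (rule stage_receive[OF _ _ y]) (use i in auto)
  also have "super_tensor_id
      (branching_channel ({..<point_ws_dim i} \<times> B i) (A (Suc i)) (point_ws_dim (Suc i)) (next_label i) (next_prob i)) \<dots> =
     rank_one (\<lambda>((a, w), x). if x \<in> ?K \<and> a \<in> A (Suc i) \<and> w < point_ws_dim (Suc i) \<and> w = next_label i a (?i0 x)
      then of_real (sqrt (next_prob i a (?i0 x))) * ?c x else 0)"
  proof (rule branching_channel_rank_one)
    show "finite ({..<point_ws_dim i} \<times> B i)" using finB i by auto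
    show "?i0 x \<in> {..<point_ws_dim i} \<times> B i" if "x \<in> ?K" for x
      using enumerate_set_less[OF fin(1) mem[OF that]] yi by (simp add: dims)
    fix p x assume "p \<in> {..<point_ws_dim i} \<times> B i"
    then show "(\<lambda>((w, v), x). if w < ws_dim point_strategy i \<and> v = y i \<and> x \<in> ?K \<and>
        w = enumerate_set (transcripts i) (x, restrict y {1..<i}) then ?c x else 0) (p, x) =
      (if x \<in> ?K \<and> p = ?i0 x then ?c x else 0)"
      by (cases p) (auto simp: point_strategy_def)
  qed
  also have "\<dots> = rank_one (stage_amp y i)"
  proof (intro arg_cong[where f = rank_one] ext)
    fix q :: "('a \<times> nat) \<times> (nat \<Rightarrow> 'a)"
    obtain a w x where q: "q = ((a, w), x)" by (cases q) auto
    show "(\<lambda>((a, w), x). if x \<in> ?K \<and> a \<in> A (Suc i) \<and> w < point_ws_dim (Suc i) \<and> w = next_label i a (?i0 x)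
      then of_real (sqrt (next_prob i a (?i0 x))) * ?c x else 0) q = stage_amp y i q"
    proof (cases "x \<in> ?K \<and> a \<in> A (Suc i)")
      case True
      then have x: "x \<in> ?K" and a: "a \<in> A (Suc i)" by auto
      let ?p = "(x(Suc i := a), restrict y {1..<Suc i})"
      have glue: "(restrict y {1..<i})(i := y i) = restrict y {1..<Suc i}"
        by (rule restrict_extend) (use i in auto)
      have mem': "?p \<in> transcripts (Suc i)"
        using transcripts_Suc[OF mem[OF x] _ a yi, unfolded glue] i by simp
      have lbl: "next_label i a (?i0 x) = enumerate_set (transcripts (Suc i)) ?p"
        by (simp only: next_label_def prod.case label_of_enumerate[OF fin(1) mem[OF x]] glue)
      have prb: "next_prob i a (?i0 x) = (if \<sigma> i (x, restrict y {1..<i}) = 0 then of_bool (a = x0 (Suc i))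
          else \<sigma> (Suc i) ?p / \<sigma> i (x, restrict y {1..<i}))"
        by (simp only: next_prob_def prod.case label_of_enumerate[OF fin(1) mem[OF x]] glue)
      have nn: "0 \<le> \<sigma> (Suc i) (x(Suc i := b), restrict y {1..<Suc i})" if "b \<in> A (Suc i)" for b
        by (rule sigma_nonneg) (use transcripts_Suc[OF mem[OF x] _ that yi, unfolded glue] i in auto)
      have nn': "0 \<le> \<sigma> i (x, restrict y {1..<i})"
        by (rule sigma_nonneg) (use mem[OF x] i in auto)
      have "\<sigma> (Suc i) ?p \<le> (\<Sum>b\<in>A (Suc i). \<sigma> (Suc i) (x(Suc i := b), restrict y {1..<Suc i}))"
        by (rule member_le_sum[OF a, of "\<lambda>b. \<sigma> (Suc i) (x(Suc i := b), restrict y {1..<Suc i})"])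
          (use nn finA i in auto)
      also have "\<dots> = \<sigma> i (x, restrict y {1..<i})"
        by (rule sigma_Suc_sum[OF i(1) mem[OF x] yi, unfolded glue])
      finally have le: "\<sigma> (Suc i) ?p \<le> \<sigma> i (x, restrict y {1..<i})" .
      have amp: "complex_of_real (sqrt (next_prob i a (?i0 x))) * ?c x = of_real (sqrt (\<sigma> (Suc i) ?p))"
        unfolding prb of_real_mult[symmetric] sqrt_share[OF nn' nn[OF a] le] ..
      show ?thesis
        using True enumerate_set_less[OF fin(2) mem'] unfolding q prod.case amp lbl
        by (simp add: stage_amp_def Let_def dims del: fun_upd_apply)
    next
      case False
      then show ?thesis by (auto simp: q stage_amp_def Let_def)
    qed
  qed
  finally show ?case by (simp add: i_def)
qed

lemma point_strategy_branch_final: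
  assumes y: "y \<in> PiE {1..n} B"
  shows "branch_final n A point_strategy y =
    rank_one (\<lambda>(((a, x'), w), x). if x \<in> PiE {1..n} A \<and> x' = x \<and> w = enumerate_set (PiE {1..n} B) y
      then of_real (sqrt (s (a, x, y))) else 0)"
proof -
  let ?i0 = "\<lambda>x. (enumerate_set (transcripts n) (x, restrict y {1..<n}), y n)"
  let ?c = "\<lambda>x. complex_of_real (sqrt (\<sigma> n (x, restrict y {1..<n})))"
  let ?K = "PiE {1..<Suc n} A"
  have K: "?K = PiE {1..n} A" by (simp add: atLeastLessThanSuc_atLeastAtMost)
  have fin: "finite (transcripts n)" "finite (PiE {1..n} B)"
    using finB by (auto intro!: finite_transcripts finite_PiE)
  have dims: "point_ws_dim n = card (transcripts n)" "point_ws_dim (Suc n) = card (PiE {1..n} B)"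
    by (auto simp: point_ws_dim_def)
  have yn: "y n \<in> B n" by (rule PiE_mem[OF y]) (use n in auto)
  have mem: "(x, restrict y {1..<n}) \<in> transcripts n" if "x \<in> ?K" for x
    by (rule transcript_prefix[OF that y]) auto
  have glue: "(restrict y {1..<n})(n := y n) = y"
    using restrict_extend[OF n, of y] y
    by (simp add: atLeastLessThanSuc_atLeastAtMost PiE_restrict del: fun_upd_apply)
  have "branch_final n A point_strategy y = super_tensor_id
      (branching_channel ({..<point_ws_dim n} \<times> B n) (UNIV \<times> PiE {1..n} A) (point_ws_dim (Suc n)) reveal_label reveal_prob)
      (receive A point_strategy n (y n) (rank_one (stage_amp y (n - 1))))"
    using point_strategy_branch_state[of "n - 1" y] n y by (simp add: branch_final_def point_strategy_def)
  also have "receive A point_strategy n (y n) (rank_one (stage_amp y (n - 1))) =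
     rank_one (\<lambda>((w, v), x). if w < ws_dim point_strategy n \<and> v = y n \<and> x \<in> ?K \<and>
        w = enumerate_set (transcripts n) (x, restrict y {1..<n}) then ?c x else 0)"
    by (rule stage_receive[OF n _ y]) auto
  also have "super_tensor_id
      (branching_channel ({..<point_ws_dim n} \<times> B n) (UNIV \<times> PiE {1..n} A) (point_ws_dim (Suc n)) reveal_label reveal_prob) \<dots> =
     rank_one (\<lambda>((o1, w), x). if x \<in> ?K \<and> o1 \<in> UNIV \<times> PiE {1..n} A \<and> w < point_ws_dim (Suc n) \<and> w = reveal_label o1 (?i0 x)
      then of_real (sqrt (reveal_prob o1 (?i0 x))) * ?c x else 0)"
  proof (rule branching_channel_rank_one)
    show "finite ({..<point_ws_dim n} \<times> B n)" using finB n by auto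
    show "?i0 x \<in> {..<point_ws_dim n} \<times> B n" if "x \<in> ?K" for x
      using enumerate_set_less[OF fin(1) mem[OF that]] yn by (simp add: dims)
    fix p x assume "p \<in> {..<point_ws_dim n} \<times> B n"
    then show "(\<lambda>((w, v), x). if w < ws_dim point_strategy n \<and> v = y n \<and> x \<in> ?K \<and>
        w = enumerate_set (transcripts n) (x, restrict y {1..<n}) then ?c x else 0) (p, x) =
      (if x \<in> ?K \<and> p = ?i0 x then ?c x else 0)"
      by (cases p) (auto simp: point_strategy_def)
  qed
  also have "\<dots> = rank_one (\<lambda>(((a, x'), w), x). if x \<in> PiE {1..n} A \<and> x' = x \<and> w = enumerate_set (PiE {1..n} B) y
      then of_real (sqrt (s (a, x, y))) else 0)"
    (is "rank_one ?l = rank_one ?r")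
  proof (intro arg_cong[where f = rank_one] ext)
    fix q :: "((bool \<times> (nat \<Rightarrow> 'a)) \<times> nat) \<times> (nat \<Rightarrow> 'a)"
    obtain a x' w x where q: "q = (((a, x'), w), x)" by (cases q) auto
    show "?l q = ?r q"
    proof (cases "x \<in> ?K")
      case x: True
      have lbl: "reveal_label (a, x') (?i0 x) = enumerate_set (PiE {1..n} B) y"
        by (simp only: reveal_label_def prod.case label_of_enumerate[OF fin(1) mem[OF x]] glue)
      have prb: "reveal_prob (a, x') (?i0 x) = (if x' \<noteq> x then 0 else
          if \<sigma> n (x, restrict y {1..<n}) = 0 then of_bool a else s (a, x, y) / \<sigma> n (x, restrict y {1..<n}))"
        by (simp only: reveal_prob_def prod.case label_of_enumerate[OF fin(1) mem[OF x]] glue)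
      have nn: "0 \<le> s (b, x, y)" for b
        by (rule reveal_nonneg[OF mem[OF x] yn, unfolded glue])
      have nn': "0 \<le> \<sigma> n (x, restrict y {1..<n})"
        by (rule sigma_nonneg) (use mem[OF x] n in auto)
      have "s (a, x, y) \<le> (\<Sum>b\<in>UNIV. s (b, x, y))"
        by (rule member_le_sum) (use nn in auto)
      also have "\<dots> = \<sigma> n (x, restrict y {1..<n})"
        by (rule reveal_sum[OF mem[OF x] yn, unfolded glue])
      finally have le: "s (a, x, y) \<le> \<sigma> n (x, restrict y {1..<n})" .
      have "complex_of_real (sqrt (if \<sigma> n (x, restrict y {1..<n}) = 0 then of_bool a
          else s (a, x, y) / \<sigma> n (x, restrict y {1..<n}))) * ?c x = of_real (sqrt (s (a, x, y)))"
        unfolding of_real_mult[symmetric] sqrt_share[OF nn' nn le] ..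
      then have amp: "complex_of_real (sqrt (reveal_prob (a, x') (?i0 x))) * ?c x =
          (if x' = x then of_real (sqrt (s (a, x, y))) else 0)"
        unfolding prb by (cases "x' = x") simp_all
      show ?thesis
        using x enumerate_set_less[OF fin(2) y] unfolding q prod.case amp lbl dims by (auto simp: K)
    next
      case False
      then show ?thesis unfolding q K by simp
    qed
  qed
  finally show ?thesis .
qed

lemma point_strategy_valid: "valid_strategy n A B point_strategy"
  unfolding valid_strategy_def
proof (intro conjI ballI)
  let ?u = "\<lambda>p. stage_amp (\<lambda>_. undefined) 0 (p, \<lambda>_. undefined)"
  let ?I = "A 1 \<times> {..<ws_dim point_strategy 1}"
  have r: "restrict (\<lambda>_. undefined) {1..<Suc 0} = (\<lambda>_. undefined :: 'b)" by (auto simp: restrict_def)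
  let ?p = "\<lambda>a. ((\<lambda>_. undefined)(1 := a), \<lambda>_. undefined :: 'b)"
  have fin: "finite (transcripts 1)" using n by (intro finite_transcripts) auto
  have dim: "ws_dim point_strategy 1 = card (transcripts 1)"
    using n by (simp add: point_strategy_def point_ws_dim_def)
  have u: "?u (a, w) = (if a \<in> A 1 \<and> w = enumerate_set (transcripts 1) (?p a) then of_real (sqrt (\<sigma> 1 (?p a))) else 0)"
    for a w unfolding stage_amp_def by (simp add: r Let_def)
  have mem: "?p a \<in> transcripts 1" if "a \<in> A 1" for a
    using that by (auto simp: transcripts_def PiE_def extensional_def)
  have psd: "psd ?I (rank_one ?u)"
  proof (rule psd_rank_one)
    fix p assume "p \<notin> ?I"
    then show "?u p = 0"
      using enumerate_set_less[OF fin mem] by (cases p) (auto simp: u dim simp del: One_nat_def)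
  qed
  have "op_trace ?I (rank_one ?u) = (\<Sum>a\<in>A 1. \<Sum>w<card (transcripts 1). ?u (a, w) * cnj (?u (a, w)))"
    by (simp only: op_trace_def rank_one_def sum.cartesian_product' dim)
  also have "\<dots> = (\<Sum>a\<in>A 1. \<Sum>w<card (transcripts 1).
      if w = enumerate_set (transcripts 1) (?p a) then of_real (\<sigma> 1 (?p a)) else 0)"
    using sigma_nonneg[of 1, OF _ mem] n
    by (intro sum.cong refl) (simp add: u flip: of_real_mult)
  also have "\<dots> = of_real (\<Sum>a\<in>A 1. \<sigma> 1 (?p a))"
    unfolding of_real_sum by (intro sum.cong refl) (use enumerate_set_less[OF fin mem] in simp)
  also have "(\<Sum>a\<in>A 1. \<sigma> 1 (?p a)) = (\<Sum>x\<in>PiE {1..1} A. \<sigma> 1 (x, \<lambda>_. undefined))"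
    by (rule sum.reindex_bij_witness[where i = "\<lambda>x. x 1" and j = "\<lambda>a. (\<lambda>_. undefined)(1 := a)"])
      (auto simp: PiE_def extensional_def)
  also have "\<dots> = (\<Sum>p\<in>PiE {1..1} A \<times> PiE {1..<1} B. \<sigma> 1 p)"
    by (simp add: sum.cartesian_product')
  also have "\<dots> = 1" by (rule poly(3))
  finally show "density_op ?I (init_state point_strategy)"
    using psd by (simp add: density_op_def point_strategy_def)
next
  fix i assume "i \<in> {1..<n}"
  from round_channel[OF this]
  show "quantum_channel ({..<ws_dim point_strategy i} \<times> B i)
      (A (Suc i) \<times> {..<ws_dim point_strategy (Suc i)}) (round_op point_strategy i)"
    by (simp add: point_strategy_def)
next
  show "quantum_channel ({..<ws_dim point_strategy n} \<times> B n)
      ((UNIV \<times> PiE {1..n} A) \<times> {..<ws_dim point_strategy (Suc n)}) (reveal_op point_strategy)"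
    using reveal_channel by (simp add: point_strategy_def)
next
  let ?P = "{..<point_ws_dim (Suc n)} \<times> (UNIV :: bool set) \<times> PiE {1..n} B"
  have fin: "finite ?P" using finB by (intro finite_cartesian_product finite_PiE) auto
  have "psd ?P (\<lambda>i j. \<Sum>p\<in>?P. rank_one (basis_vec p) i j)"
    by (intro psd_sum psd_rank_one) (auto simp: basis_vec_def)
  also have "(\<lambda>i j. \<Sum>p\<in>?P. rank_one (basis_vec p) i j) = (\<lambda>p q. of_bool (p = q \<and> p \<in> ?P))"
  proof (intro ext)
    fix i j
    have "(\<Sum>p\<in>?P. rank_one (basis_vec p) i j) = (\<Sum>p\<in>?P. if p = i then of_bool (i = j) else 0)"
      by (intro sum.cong refl) (auto simp: rank_one_def basis_vec_def)
    also have "\<dots> = of_bool (i = j \<and> i \<in> ?P)" using fin by simp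
    finally show "(\<Sum>p\<in>?P. rank_one (basis_vec p) i j) = of_bool (i = j \<and> i \<in> ?P)" .
  qed
  finally show "povm (alice_final_basis n B point_strategy) (n_out point_strategy) (final_meas point_strategy)"
    by (simp add: povm_def alice_final_basis_def point_strategy_def)
qed

text \<open>
  In the branch of \<open>y\<close> the final state is a product of the workspace label of \<open>y\<close> with a vector on the diagonal
  \<open>A = A'\<close> with amplitudes \<open>sqrt (s (a, x, y))\<close>, so Bob's projection onto \<open>\<psi>\<^sub>a\<close> gives the square of an inner
  product.
\<close>
lemma point_strategy_output_prob:
  assumes \<beta>: "\<And>b y. y \<in> PiE {1..n} B \<Longrightarrow> 0 \<le> \<beta> b y"
  shows "bob_output_prob n A B \<alpha> \<beta> point_strategy c = alice_objective n A B \<alpha> \<beta> c (\<sigma>, s)"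
proof -
  let ?X = "PiE {1..n} A" and ?Y = "PiE {1..n} B"
  have fin: "finite ?X" "finite ?Y" using finA finB by (auto intro!: finite_PiE)
  have dim: "ws_dim point_strategy (Suc n) = card ?Y"
    by (simp add: point_strategy_def point_ws_dim_def)
  have inner: "(\<Sum>w<ws_dim point_strategy (Suc n).
        branch_final n A point_strategy y (((a, z), w), z) (((a, x), w), x))
      = of_real (sqrt (s (a, z, y)) * sqrt (s (a, x, y)))"
    if "y \<in> ?Y" "x \<in> ?X" "z \<in> ?X" for a x y z
  proof -
    have "(\<Sum>w<ws_dim point_strategy (Suc n).
        branch_final n A point_strategy y (((a, z), w), z) (((a, x), w), x))
      = (\<Sum>w<card ?Y. if w = enumerate_set ?Y y then of_real (sqrt (s (a, z, y)) * sqrt (s (a, x, y))) else 0)"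
      unfolding dim point_strategy_branch_final[OF that(1)]
      by (intro sum.cong refl) (use that in \<open>auto simp: rank_one_def\<close>)
    then show ?thesis using enumerate_set_less[OF fin(2) that(1)] by simp
  qed
  have "bob_output_prob n A B \<alpha> \<beta> point_strategy c =
    (\<Sum>a\<in>UNIV. \<Sum>y\<in>?Y. \<beta> (a \<noteq> c) y / 2 *
      Re (\<Sum>x\<in>?X. \<Sum>z\<in>?X. of_real (sqrt (\<alpha> a x) * sqrt (\<alpha> a z)) *
        (\<Sum>w<ws_dim point_strategy (Suc n).
          branch_final n A point_strategy y (((a, z), w), z) (((a, x), w), x))))"
    by (rule bob_output_prob_eq[OF n point_strategy_valid fin]) (rule \<beta>)
  also have "\<dots> = (\<Sum>a\<in>UNIV. \<Sum>y\<in>?Y. \<beta> (a \<noteq> c) y / 2 * fidelity ?X (\<lambda>x. s (a, x, y)) (\<alpha> a))"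
  proof (intro sum.cong refl arg_cong2[where f = "(*)"])
    fix a y assume y: "y \<in> ?Y"
    have "(\<Sum>x\<in>?X. \<Sum>z\<in>?X. of_real (sqrt (\<alpha> a x) * sqrt (\<alpha> a z)) *
        (\<Sum>w<ws_dim point_strategy (Suc n).
          branch_final n A point_strategy y (((a, z), w), z) (((a, x), w), x)))
      = (\<Sum>x\<in>?X. \<Sum>z\<in>?X. complex_of_real ((sqrt (s (a, x, y)) * sqrt (\<alpha> a x)) * (sqrt (s (a, z, y)) * sqrt (\<alpha> a z))))"
      by (intro sum.cong refl) (simp add: inner[OF y] mult_ac)
    also have "\<dots> = of_real (fidelity ?X (\<lambda>x. s (a, x, y)) (\<alpha> a))"
      by (simp only: fidelity_def power2_eq_square sum_product of_real_sum)
    finally show "Re (\<Sum>x\<in>?X. \<Sum>z\<in>?X. of_real (sqrt (\<alpha> a x) * sqrt (\<alpha> a z)) *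
        (\<Sum>w<ws_dim point_strategy (Suc n).
          branch_final n A point_strategy y (((a, z), w), z) (((a, x), w), x)))
      = fidelity ?X (\<lambda>x. s (a, x, y)) (\<alpha> a)" by simp
  qed
  also have "\<dots> = alice_objective n A B \<alpha> \<beta> c (\<sigma>, s)"
    by (simp add: alice_objective_def sum_distrib_left mult.assoc)
  finally show ?thesis .
qed

end

section \<open>The optimal cheating probability\<close>

theorem theorem4p6:
  fixes n :: nat
    and A :: "nat \<Rightarrow> 'a set" and B :: "nat \<Rightarrow> 'b set"
    and \<alpha> :: "bool \<Rightarrow> (nat \<Rightarrow> 'a) \<Rightarrow> real" and \<beta> :: "bool \<Rightarrow> (nat \<Rightarrow> 'b) \<Rightarrow> real"
    and c :: bool
  assumes "n \<ge> 1"
    and "\<And>i. i \<in> {1..n} \<Longrightarrow> finite (A i)"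
    and "\<And>i. i \<in> {1..n} \<Longrightarrow> finite (B i)"
    and "\<And>a. prob_vector (PiE {1..n} A) (\<alpha> a)"
    and "\<And>b. prob_vector (PiE {1..n} B) (\<beta> b)"
  shows "convex_maximization_problem (alice_polytope n A B) (alice_objective n A B \<alpha> \<beta> c)
    \<and> P_A_star n A B \<alpha> \<beta> c \<in> alice_objective n A B \<alpha> \<beta> c ` alice_polytope n A B
    \<and> (\<forall>p\<in>alice_polytope n A B. alice_objective n A B \<alpha> \<beta> c p \<le> P_A_star n A B \<alpha> \<beta> c)"
proof -
  let ?K = "alice_polytope n A B" and ?f = "alice_objective n A B \<alpha> \<beta> c"
  have \<alpha>: "0 \<le> \<alpha> a x" if "x \<in> PiE {1..n} A" for a x
    using assms(4)[of a] that by (simp add: prob_vector_def)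
  have \<beta>: "0 \<le> \<beta> b y" if "y \<in> PiE {1..n} B" for b y
    using assms(5)[of b] that by (simp add: prob_vector_def)
  have ne: "PiE {1..n} A \<noteq> {}"
  proof
    assume "PiE {1..n} A = {}"
    then show False using assms(4)[of True] by (simp add: prob_vector_def)
  qed
  then obtain x0 where x0: "x0 \<in> PiE {1..n} A" by blast
  have convex: "convex_maximization_problem ?K ?f"
    unfolding convex_maximization_problem_def
    by (auto intro!: alice_polytope_convex alice_objective_concave \<alpha> \<beta>)
  obtain p where p: "p \<in> ?K" and max: "\<And>q. q \<in> ?K \<Longrightarrow> ?f q \<le> ?f p"
    by (rule alice_objective_attains_max[where B = B and \<alpha> = \<alpha> and \<beta> = \<beta> and c = c, OF assms(1,2) ne])
      (assumption, erule that, simp)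
  obtain \<sigma> s where ps: "p = (\<sigma>, s)" by (cases p)
  let ?S = "point_strategy n A B \<sigma> s x0"
  let ?V = "{bob_output_prob n A B \<alpha> \<beta> S c | S. valid_strategy n A B S}"
  have "P_A_star n A B \<alpha> \<beta> c = ?f p"
    unfolding P_A_star_def
  proof (rule cSup_eq_maximum)
    have "valid_strategy n A B ?S" "bob_output_prob n A B \<alpha> \<beta> ?S c = ?f p"
      using point_strategy_valid[OF assms(1-3) x0 p[unfolded ps]]
        point_strategy_output_prob[OF assms(1-3) x0 p[unfolded ps] \<beta>] by (simp_all add: ps)
    then show "?f p \<in> ?V" by force
    fix v assume "v \<in> ?V"
    then obtain S where S: "valid_strategy n A B S" "v = bob_output_prob n A B \<alpha> \<beta> S c" by auto
    have "\<exists>q\<in>?K. v \<le> ?f q"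
      unfolding S(2) by (rule bob_output_prob_le_objective[OF assms(1-3) S(1)]) (auto simp: \<alpha> \<beta>)
    then obtain q where "q \<in> ?K" "v \<le> ?f q" by blast
    with max[of q] show "v \<le> ?f p" by simp
  qed
  with p max convex show ?thesis by auto
qed

end
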